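(* Let $1\le p\le\infty$, let $u,\psi$ be entire functions on $\mathbb{C}$ such that the weighted composition operator $W_{(u,\psi)}$ is bounded on the Fock space $\mathcal{F}_p$, and let $\psi(z)=az+b$ with $a,b\in\mathbb{C}$, $|a|<1$. Suppose that $u$ is non-vanishing on $\mathbb{C}$ and that $W_{(u,\psi)}$ is compact on $\mathcal{F}_p$. Then the following statements are equivalent: (i) $W_{(u,\psi)}$ is power bounded on $\mathcal{F}_p$; (ii) $(\|u_n\|_p)_n$ is a bounded sequence, where $u_n(z)=\prod_{j=0}^{n-1}u(\psi^j(z))$; (iii) $\big|u\big(\frac{b}{1-a}\big)\big|\le 1$.
   Context: For $1\le p<\infty$, the Fock space $\mathcal{F}_p$ consists of all entire functions $f$ on $\mathbb{C}$ with $\|f\|_p=\Big(\frac{p}{2\pi}\int_{\mathbb{C}}|f(z)|^pe^{-\frac{p|z|^2}{2}}dA(z)\Big)^{1/p}<\infty$, where $dA$ is Lebesgue area measure; $\mathcal{F}_\infty$ consists of all entire $f$ with $\|f\|_\infty=\sup_{z\in\mathbb{C}}|f(z)|e^{-\frac{|z|^2}{2}}<\infty$. For entire $u,\psi$, the weighted composition operator is $W_{(u,\psi)}f=u\cdot (f\circ\psi)$. Here $\psi^j$ denotes the $j$-th iterate of $\psi$ under composition, $\psi^0$ being the identity map. A bounded operator $T$ on a Banach space is power bounded if $\sup_{n\in\mathbb{N}}\|T^n\|<\infty$. *)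

theory Defs
  imports "HOL-Analysis.Analysis"
begin

section \<open>Fock spaces\<close>

text \<open>The exponent ranges over extended reals with \<open>1 \<le> p\<close>. For \<open>p = \<infinity>\<close> the weight is
  \<open>exp (- \<bar>z\<bar>\<^sup>2 / 2)\<close>, for finite \<open>p\<close> its \<open>p\<close>-th power appears under the integral. Area measure
  is \<open>lborel\<close> on the Euclidean space \<open>complex\<close>.\<close>

definition fock_space :: "ereal \<Rightarrow> (complex \<Rightarrow> complex) set" where
  "fock_space p = {f. f holomorphic_on UNIV \<and>
     (if p = \<infinity> then bdd_above (range (\<lambda>z. cmod (f z) * exp (- (cmod z)\<^sup>2 / 2)))
      else integrable lborel
        (\<lambda>z. cmod (f z) powr real_of_ereal p * exp (- real_of_ereal p * (cmod z)\<^sup>2 / 2)))}"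

text \<open>The value is the norm only for members of \<open>fock_space p\<close>; elsewhere the real-valued
  integral and supremum are unspecified or zero.\<close>

definition fock_norm :: "ereal \<Rightarrow> (complex \<Rightarrow> complex) \<Rightarrow> real" where
  "fock_norm p f =
     (if p = \<infinity> then (SUP z. cmod (f z) * exp (- (cmod z)\<^sup>2 / 2))
      else (real_of_ereal p / (2 * pi) *
            (LINT z|lborel. cmod (f z) powr real_of_ereal p
                            * exp (- real_of_ereal p * (cmod z)\<^sup>2 / 2)))
           powr (1 / real_of_ereal p))"

section \<open>Operators on a normed space of functions\<close>

text \<open>Since \<open>fock_space p\<close> depends on \<open>p\<close> it is not a type, so the library's \<open>bounded_linear\<close>
  and \<open>onorm\<close> do not apply; the notions below are relative to a carrier \<open>V\<close> with norm \<open>N\<close>.\<close>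

definition bounded_operator_on ::
  "(complex \<Rightarrow> complex) set \<Rightarrow> ((complex \<Rightarrow> complex) \<Rightarrow> real) \<Rightarrow>
   ((complex \<Rightarrow> complex) \<Rightarrow> (complex \<Rightarrow> complex)) \<Rightarrow> bool" where
  "bounded_operator_on V N T \<longleftrightarrow>
     (\<forall>f\<in>V. T f \<in> V) \<and>
     (\<forall>f\<in>V. \<forall>g\<in>V. T (\<lambda>z. f z + g z) = (\<lambda>z. T f z + T g z)) \<and>
     (\<forall>c. \<forall>f\<in>V. T (\<lambda>z. c * f z) = (\<lambda>z. c * T f z)) \<and>
     (\<exists>C. \<forall>f\<in>V. N (T f) \<le> C * N f)"

definition operator_norm_on ::
  "(complex \<Rightarrow> complex) set \<Rightarrow> ((complex \<Rightarrow> complex) \<Rightarrow> real) \<Rightarrow>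
   ((complex \<Rightarrow> complex) \<Rightarrow> (complex \<Rightarrow> complex)) \<Rightarrow> real" where
  "operator_norm_on V N T = (SUP f\<in>{f\<in>V. N f \<le> 1}. N (T f))"

definition compact_operator_on ::
  "(complex \<Rightarrow> complex) set \<Rightarrow> ((complex \<Rightarrow> complex) \<Rightarrow> real) \<Rightarrow>
   ((complex \<Rightarrow> complex) \<Rightarrow> (complex \<Rightarrow> complex)) \<Rightarrow> bool" where
  "compact_operator_on V N T \<longleftrightarrow>
     bounded_operator_on V N T \<and>
     (\<forall>s :: nat \<Rightarrow> complex \<Rightarrow> complex.
        (\<forall>n. s n \<in> V) \<and> (\<exists>C. \<forall>n. N (s n) \<le> C) \<longrightarrow>
        (\<exists>g\<in>V. \<exists>r. strict_mono (r :: nat \<Rightarrow> nat) \<and>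
           (\<lambda>n. N (\<lambda>z. T (s (r n)) z - g z)) \<longlonglongrightarrow> 0))"

definition power_bounded_on ::
  "(complex \<Rightarrow> complex) set \<Rightarrow> ((complex \<Rightarrow> complex) \<Rightarrow> real) \<Rightarrow>
   ((complex \<Rightarrow> complex) \<Rightarrow> (complex \<Rightarrow> complex)) \<Rightarrow> bool" where
  "power_bounded_on V N T \<longleftrightarrow>
     bounded_operator_on V N T \<and> bdd_above (range (\<lambda>n. operator_norm_on V N (T ^^ n)))"

section \<open>Weighted composition operators\<close>

definition weighted_comp ::
  "(complex \<Rightarrow> complex) \<Rightarrow> (complex \<Rightarrow> complex) \<Rightarrow> (complex \<Rightarrow> complex) \<Rightarrow> complex \<Rightarrow> complex" where
  "weighted_comp u \<psi> f = (\<lambda>z. u z * f (\<psi> z))"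

definition weight_iter ::
  "(complex \<Rightarrow> complex) \<Rightarrow> (complex \<Rightarrow> complex) \<Rightarrow> nat \<Rightarrow> complex \<Rightarrow> complex" where
  "weight_iter u \<psi> n = (\<lambda>z. \<Prod>j<n. u ((\<psi> ^^ j) z))"

end

theory Submission
  imports Defs "HOL-Complex_Analysis.Complex_Analysis"
begin

text \<open>
  Write \<open>z\<^sub>0 = b / (1 - a)\<close> for the fixed point of \<open>\<psi>\<close> and \<open>w(f)(z) = \<bar>f z\<bar> exp (- \<bar>z\<bar>\<^sup>2 / 2)\<close>.
  The operator multiplies \<open>w(f) \<circ> \<psi>\<close> by
  \<open>M(z) = \<bar>u z\<bar> exp ((\<bar>\<psi> z\<bar>\<^sup>2 - \<bar>z\<bar>\<^sup>2) / 2)\<close>. Testing on the normalised reproducing kernels shows that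
  \<open>M\<close> is bounded and, by compactness, vanishes at infinity when \<open>a \<noteq> 0\<close>. Since \<open>u = exp q\<close> has no
  zeros, boundedness bounds \<open>Re q\<close> by a quadratic, so \<open>q\<close> is a quadratic polynomial, and decay
  of \<open>M\<close> upgrades itself to \<open>M(z\<^sub>0 + x) \<le> \<bar>u z\<^sub>0\<bar> exp (L \<bar>x\<bar> - \<epsilon> \<bar>x\<bar>\<^sup>2)\<close>. If \<open>\<bar>u z\<^sub>0\<bar> \<le> 1\<close>, multiplying
  these bounds along the orbit \<open>z\<^sub>0 + a\<^sup>j x\<close> gives a Gaussian bound for the weight of \<open>T\<^sup>n f\<close> which is
  uniform in \<open>n \<ge> 1\<close>, hence power boundedness. Applying \<open>T\<^sup>n\<close> to the constant \<open>1\<close> gives \<open>u\<^sub>n\<close>, and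
  \<open>u\<^sub>n z\<^sub>0 = (u z\<^sub>0)\<^sup>n\<close> together with continuity of point evaluation gives the other implications.
\<close>

section \<open>Area integrals over the complex plane\<close>

lemma nn_integral_lborel_translate:
  fixes f :: "'a::euclidean_space \<Rightarrow> ennreal"
  assumes [measurable]: "f \<in> borel_measurable borel"
  shows "(\<integral>\<^sup>+z. f (c + z) \<partial>lborel) = (\<integral>\<^sup>+z. f z \<partial>lborel)"
proof -
  have "(\<integral>\<^sup>+z. f z \<partial>lborel) = (\<integral>\<^sup>+z. f z \<partial>distr lborel borel ((+) c))"
    by (simp add: lborel_distr_plus)
  also have "\<dots> = (\<integral>\<^sup>+z. f (c + z) \<partial>lborel)"
    by (subst nn_integral_distr) auto
  finally show ?thesis by simp
qed

text \<open>Convolving with the indicator of the unit disc, which is itself invariant, reduces rotations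
  to translations.\<close>
lemma nn_integral_complex_rotate:
  fixes f :: "complex \<Rightarrow> ennreal"
  assumes [measurable]: "f \<in> borel_measurable borel" and c: "cmod c = 1"
  shows "(\<integral>\<^sup>+z. f (c * z) \<partial>lborel) = (\<integral>\<^sup>+z. f z \<partial>lborel)"
proof -
  define B where "B = (indicator (ball 0 1) :: complex \<Rightarrow> ennreal)"
  define m where "m = (\<integral>\<^sup>+w. B w \<partial>lborel)"
  have [measurable]: "B \<in> borel_measurable borel" unfolding B_def by (rule borel_measurable_indicator) simp
  \<comment> \<open>The factor \<open>m\<close>, the area of the disc, is inserted on both sides and
    must be cancellable in \<open>ennreal\<close> at the end.\<close>
  have m: "m \<noteq> 0" "m \<noteq> \<infinity>"
    using unit_ball_vol_pos[of 2] by (auto simp: m_def B_def emeasure_ball unit_ball_vol_2)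
  have c_unit: "c * cnj c = 1" by (subst complex_norm_square[symmetric]) (simp add: c)
  then have cc: "c * (cnj c * w) = w" for w by (simp flip: mult.assoc)
  have "m * (\<integral>\<^sup>+z. f (c * z) \<partial>lborel) = (\<integral>\<^sup>+w. B w * (\<integral>\<^sup>+z. f (c * z) \<partial>lborel) \<partial>lborel)"
    unfolding m_def by (subst nn_integral_multc) auto
  \<comment> \<open>The inner integral may be shifted by any amount depending on \<open>w\<close>;
    the shift \<open>cnj c * w\<close> becomes \<open>w\<close> after multiplication by
    \<open>c\<close>.\<close>
  also have "\<dots> = (\<integral>\<^sup>+w. B w * (\<integral>\<^sup>+z. f (c * (cnj c * w + z)) \<partial>lborel) \<partial>lborel)"
    by (subst nn_integral_lborel_translate[where f="\<lambda>z. f (c * z)"]) auto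
  also have "\<dots> = (\<integral>\<^sup>+w. (\<integral>\<^sup>+z. B w * f (w + c * z) \<partial>lborel) \<partial>lborel)"
    by (subst nn_integral_cmult) (auto simp: distrib_left cc)
  also have "\<dots> = (\<integral>\<^sup>+z. (\<integral>\<^sup>+w. B w * f (w + c * z) \<partial>lborel) \<partial>lborel)"
    by (rule lborel_pair.Fubini') measurable
  also have "\<dots> = (\<integral>\<^sup>+z. (\<integral>\<^sup>+w. B (w - c * z) * f w \<partial>lborel) \<partial>lborel)"
  proof (rule nn_integral_cong)
    fix z
    show "(\<integral>\<^sup>+w. B w * f (w + c * z) \<partial>lborel) = (\<integral>\<^sup>+w. B (w - c * z) * f w \<partial>lborel)"
      using nn_integral_lborel_translate[where f="\<lambda>w. B (w - c * z) * f w" and c="c * z"]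
      by (simp add: add.commute)
  qed
  also have "\<dots> = (\<integral>\<^sup>+w. (\<integral>\<^sup>+z. B (w - c * z) * f w \<partial>lborel) \<partial>lborel)"
    by (rule lborel_pair.Fubini') measurable
  also have "\<dots> = (\<integral>\<^sup>+w. m * f w \<partial>lborel)"
  proof (rule nn_integral_cong)
    fix w
    \<comment> \<open>The two arguments differ by the unimodular factor \<open>- c\<close>, and the
      disc is invariant under it. What remains is a pure translation in \<open>z\<close>.\<close>
    have "B (w - c * z) = B (- cnj c * w + z)" for z
    proof -
      have "w - c * z = - c * (- cnj c * w + z)" by (simp add: algebra_simps c_unit)
      then have "cmod (w - c * z) = cmod (- cnj c * w + z)" by (metis c norm_minus_cancel norm_mult mult_1)
      then show ?thesis by (simp add: B_def indicator_def)
    qed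
    then have "(\<integral>\<^sup>+z. B (w - c * z) \<partial>lborel) = m"
      using nn_integral_lborel_translate[where f=B and c="- cnj c * w"] by (simp add: m_def)
    then show "(\<integral>\<^sup>+z. B (w - c * z) * f w \<partial>lborel) = m * f w"
      by (subst nn_integral_multc) auto
  qed
  also have "\<dots> = m * (\<integral>\<^sup>+z. f z \<partial>lborel)"
    by (subst nn_integral_cmult) auto
  finally show ?thesis using m by (simp add: ennreal_mult_cancel_left)
qed

section \<open>Mean value inequalities over circles and discs\<close>

lemma circle_mean_has_integral:
  assumes "f holomorphic_on UNIV"
  shows "((\<lambda>t. f (exp (2 * of_real pi * \<i> * of_real t) * z)) has_integral f 0) {0..1}"
proof -
  \<comment> \<open>Cauchy's formula is applied to a dilate on the unit circle, so that
    \<open>z\<close> stays a free parameter over which the result can later be integrated.\<close>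
  have "(\<lambda>w. f (w * z)) holomorphic_on cball 0 1"
    by (intro holomorphic_on_compose_gen[OF _ assms, unfolded o_def] holomorphic_intros) auto
  from Cauchy_integral_circlepath_simple[OF this, of 0]
  have "((\<lambda>u. f (u * z) / u) has_contour_integral 2 * of_real pi * \<i> * f 0) (circlepath 0 1)"
    by simp
  then have "((\<lambda>t. (2 * of_real pi * \<i>) * f (exp (2 * of_real pi * \<i> * of_real t) * z))
      has_integral (2 * of_real pi * \<i>) * f 0) {0..1}"
    unfolding has_contour_integral_def
    by (rule has_integral_eq[rotated])
       (auto simp: vector_derivative_circlepath01, auto simp: circlepath)
  from has_integral_mult_right[OF this, of "1 / (2 * of_real pi * \<i>)"] show ?thesis
    by simp
qed

text \<open>The triangle inequality for the circle mean, put as a nonnegative Lebesgue integral so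
  that Tonelli's theorem applies to it.\<close>

lemma circle_mean_le:
  assumes f: "f holomorphic_on UNIV"
  shows "ennreal (cmod (f 0)) \<le>
    (\<integral>\<^sup>+t. indicator {0..1} t * ennreal (cmod (f (exp (2 * of_real pi * \<i> * of_real t) * z))) \<partial>lborel)"
proof -
  let ?g = "\<lambda>t. f (exp (2 * of_real pi * \<i> * complex_of_real t) * z)"
  have cont: "continuous_on UNIV f" using f by (rule holomorphic_on_imp_continuous_on)
  have cg: "continuous_on {0..1} ?g"
    by (intro continuous_on_compose2[OF cont] continuous_intros) auto
  have cn: "continuous_on {0..1} (\<lambda>t. cmod (?g t))" using cg by (rule continuous_on_norm)
  have "cmod (f 0) = cmod (integral {0..1} ?g)"
    using circle_mean_has_integral[OF f, of z] by (simp add: integral_unique)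
  also have "\<dots> \<le> integral {0..1} (\<lambda>t. cmod (?g t))"
    by (rule integral_norm_bound_integral) (auto intro!: integrable_continuous_real cg cn)
  finally have "ennreal (cmod (f 0)) \<le> ennreal (integral {0..1} (\<lambda>t. cmod (?g t)))"
    by (rule ennreal_leI)
  also have "\<dots> = (\<integral>\<^sup>+t. ennreal (cmod (?g t)) * indicator {0..1} t \<partial>lborel)"
    using integrable_integral[OF integrable_continuous_real[OF cn]]
    by (intro nn_integral_has_integral_lebesgue'[symmetric]) auto
  also have "\<dots> = (\<integral>\<^sup>+t. indicator {0..1} t * ennreal (cmod (?g t)) \<partial>lborel)"
    by (simp add: mult.commute)
  finally show ?thesis .
qed

lemma holomorphic_borel_measurable:
  "f holomorphic_on UNIV \<Longrightarrow> f \<in> borel_measurable borel"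
  by (intro borel_measurable_continuous_onI holomorphic_on_imp_continuous_on)

text \<open>Integrating the circle inequality over \<open>z\<close> in the disc and exchanging the
  integrals leaves, for each angle, a rotated copy of the same disc integral. Rotation invariance
  thus takes the place of polar coordinates.\<close>

lemma disc_mean_le:
  assumes f: "f holomorphic_on UNIV"
  shows "ennreal (cmod (f 0)) * emeasure lborel (ball (0::complex) 1) \<le>
    (\<integral>\<^sup>+z. indicator (ball 0 1) z * ennreal (cmod (f z)) \<partial>lborel)"
proof -
  have [measurable]: "(indicator (ball 0 1) :: complex \<Rightarrow> ennreal) \<in> borel_measurable borel"
    by (rule borel_measurable_indicator) simp
  have [measurable]: "f \<in> borel_measurable borel" using f by (rule holomorphic_borel_measurable)
  have [measurable]: "(\<lambda>t. exp (2 * of_real pi * \<i> * complex_of_real t)) \<in> borel_measurable borel"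
    by (intro borel_measurable_continuous_onI continuous_intros)
  let ?e = "\<lambda>t. exp (2 * of_real pi * \<i> * complex_of_real t)"
  let ?B = "indicator (ball 0 1) :: complex \<Rightarrow> ennreal"
  have "ennreal (cmod (f 0)) * emeasure lborel (ball (0::complex) 1) = (\<integral>\<^sup>+z. ?B z * ennreal (cmod (f 0)) \<partial>lborel)"
    by (subst nn_integral_multc) (auto simp: mult.commute)
  also have "\<dots> \<le> (\<integral>\<^sup>+z. ?B z * (\<integral>\<^sup>+t. indicator {0..1} t * ennreal (cmod (f (?e t * z))) \<partial>lborel) \<partial>lborel)"
    by (intro nn_integral_mono mult_left_mono circle_mean_le f) auto
  also have "\<dots> = (\<integral>\<^sup>+z. (\<integral>\<^sup>+t. ?B z * (indicator {0..1} t * ennreal (cmod (f (?e t * z)))) \<partial>lborel) \<partial>lborel)"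
    by (subst nn_integral_cmult) auto
  also have "\<dots> = (\<integral>\<^sup>+t. (\<integral>\<^sup>+z. ?B z * (indicator {0..1} t * ennreal (cmod (f (?e t * z)))) \<partial>lborel) \<partial>lborel)"
    by (rule lborel_pair.Fubini') measurable
  also have "\<dots> = (\<integral>\<^sup>+t. indicator {0..1::real} t * (\<integral>\<^sup>+z. ?B z * ennreal (cmod (f z)) \<partial>lborel) \<partial>lborel)"
  proof (rule nn_integral_cong)
    fix t :: real
    have e: "cmod (?e t) = 1" by (simp add: norm_exp_eq_Re)
    then have B: "?B z = ?B (?e t * z)" for z
      by (simp add: indicator_def norm_mult)
    have "(\<integral>\<^sup>+z. ?B z * (indicator {0..1} t * ennreal (cmod (f (?e t * z)))) \<partial>lborel)
        = (\<integral>\<^sup>+z. indicator {0..1} t * (?B (?e t * z) * ennreal (cmod (f (?e t * z)))) \<partial>lborel)"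
      by (rule nn_integral_cong) (subst B, simp add: mult.left_commute)
    also have "\<dots> = indicator {0..1} t * (\<integral>\<^sup>+z. ?B (?e t * z) * ennreal (cmod (f (?e t * z))) \<partial>lborel)"
      by (rule nn_integral_cmult) measurable
    also have "(\<integral>\<^sup>+z. ?B (?e t * z) * ennreal (cmod (f (?e t * z))) \<partial>lborel) = (\<integral>\<^sup>+z. ?B z * ennreal (cmod (f z)) \<partial>lborel)"
      by (rule nn_integral_complex_rotate[OF _ e]) measurable
    finally show "(\<integral>\<^sup>+z. ?B z * (indicator {0..1} t * ennreal (cmod (f (?e t * z)))) \<partial>lborel) =
      indicator {0..1} t * (\<integral>\<^sup>+z. ?B z * ennreal (cmod (f z)) \<partial>lborel)" .
  qed
  also have "\<dots> = (\<integral>\<^sup>+z. ?B z * ennreal (cmod (f z)) \<partial>lborel)"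
    by (subst nn_integral_multc) auto
  finally show ?thesis .
qed

text \<open>The Gaussian is dominated by a sum of multiples \<open>exp (-1) ^ n\<close> of
  indicators of discs whose areas grow only linearly in \<open>n\<close>.\<close>

lemma gaussian_integrable_complex:
  assumes d: "d > 0"
  shows "integrable lborel (\<lambda>z::complex. exp (- d * (cmod (z - c))\<^sup>2))"
proof -
  define f where "f = (\<lambda>z::complex. exp (- d * (cmod z)\<^sup>2))"
  define g where "g = (\<lambda>n (z::complex). ennreal (exp (-1) ^ n) * indicator (ball 0 (sqrt (real (Suc n) / d))) z)"
  have [measurable]: "f \<in> borel_measurable borel" unfolding f_def by measurable
  have [measurable]: "g n \<in> borel_measurable borel" for n
  proof -
    have [measurable]: "ball (0::complex) (sqrt (real (Suc n) / d)) \<in> sets borel" by simp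
    show ?thesis unfolding g_def by measurable
  qed
  have fg: "ennreal (f z) \<le> (\<Sum>n. g n z)" for z
  proof -
    \<comment> \<open>With this \<open>n\<close> the point \<open>z\<close> lies in the disc of
      index \<open>n\<close>, and the Gaussian is at most \<open>exp (-1) ^ n\<close> there, so one
      term of the sum suffices.\<close>
    define n where "n = nat \<lfloor>d * (cmod z)\<^sup>2\<rfloor>"
    have n: "real n \<le> d * (cmod z)\<^sup>2" "d * (cmod z)\<^sup>2 < real (Suc n)"
      unfolding n_def using d by (auto simp: floor_less_iff of_nat_nat add.commute) linarith+
    have "(cmod z)\<^sup>2 < real (Suc n) / d" using n d by (simp add: field_simps)
    then have "cmod z < sqrt (real (Suc n) / d)" by (simp add: real_less_rsqrt)
    moreover have "f z \<le> exp (-1) ^ n"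
      using n unfolding f_def by (simp flip: exp_of_nat_mult)
    ultimately have "ennreal (f z) \<le> g n z"
      by (auto simp: g_def indicator_def intro!: ennreal_leI)
    also have "\<dots> \<le> (\<Sum>n. g n z)"
      using sum_le_suminf[of "\<lambda>n. g n z" "{n}"] by simp
    finally show ?thesis .
  qed
  have "summable (\<lambda>n. of_nat (Suc n) * exp (-1 :: real) ^ n)"
    using geometric_deriv_sums[of "exp (-1 :: real)"] by (simp add: sums_iff)
  then have sm: "summable (\<lambda>n. exp (-1) ^ n * (pi * (real (Suc n) / d)))"
    using summable_mult[of _ "pi / d"] by (simp add: mult_ac)
  have "(\<integral>\<^sup>+z. ennreal (f z) \<partial>lborel) \<le> (\<integral>\<^sup>+z. (\<Sum>n. g n z) \<partial>lborel)"
    by (intro nn_integral_mono fg)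
  also have "\<dots> = (\<Sum>n. \<integral>\<^sup>+z. g n z \<partial>lborel)"
    by (rule nn_integral_suminf) simp
  also have "\<dots> = (\<Sum>n. ennreal (exp (-1) ^ n * (pi * (real (Suc n) / d))))"
  proof (intro suminf_cong)
    fix n
    have "(\<integral>\<^sup>+z. g n z \<partial>lborel) = ennreal (exp (-1) ^ n) * emeasure lborel (ball (0::complex) (sqrt (real (Suc n) / d)))"
      unfolding g_def by (subst nn_integral_cmult_indicator) auto
    also have "\<dots> = ennreal (exp (-1) ^ n * (pi * (real (Suc n) / d)))"
      using d by (subst emeasure_ball) (auto simp: unit_ball_vol_2 ennreal_mult[symmetric])
    finally show "(\<integral>\<^sup>+z. g n z \<partial>lborel) = \<dots>" .
  qed
  also have "\<dots> < \<infinity>"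
  proof -
    have "(\<Sum>n. ennreal (exp (-1) ^ n * (pi * (real (Suc n) / d)))) \<noteq> top"
      by (rule ennreal_suminf_neq_top[OF sm]) (use d in auto)
    then show ?thesis by (simp add: less_top)
  qed
  finally have fin: "(\<integral>\<^sup>+z. ennreal (f z) \<partial>lborel) < \<infinity>" .
  have "(\<integral>\<^sup>+z. ennreal (f (- c + z)) \<partial>lborel) < \<infinity>"
    using fin by (subst nn_integral_lborel_translate) auto
  then have "integrable lborel (\<lambda>z. f (- c + z))"
    by (intro integrableI_nonneg) (auto simp: f_def)
  then show ?thesis by (simp add: f_def)
qed

section \<open>Norm estimates in Fock spaces\<close>

text \<open>Both norms are expressed through this function: its supremum is the norm for
  \<open>\<infinity>\<close>, and its \<open>q\<close>-th power is the integrand for finite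
  \<open>q\<close>.\<close>

definition fock_weight :: "(complex \<Rightarrow> complex) \<Rightarrow> complex \<Rightarrow> real" where
  "fock_weight f z = cmod (f z) * exp (- (cmod z)\<^sup>2 / 2)"

lemma fock_weight_nonneg [simp]: "0 \<le> fock_weight f z"
  by (simp add: fock_weight_def)

lemma fock_weight_measurable:
  "f holomorphic_on UNIV \<Longrightarrow> fock_weight f \<in> borel_measurable borel"
  using holomorphic_borel_measurable[of f] unfolding fock_weight_def by measurable

lemma fock_weight_scale: "fock_weight (\<lambda>z. c * f z) z = cmod c * fock_weight f z"
  by (simp add: fock_weight_def norm_mult)

lemma fock_weight_powr:
  "fock_weight f z powr q = cmod (f z) powr q * exp (- q * (cmod z)\<^sup>2 / 2)"
  by (simp add: fock_weight_def powr_mult exp_powr_real)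

lemma fock_space_infinity:
  "f \<in> fock_space \<infinity> \<longleftrightarrow> f holomorphic_on UNIV \<and> bdd_above (range (fock_weight f))"
  by (simp add: fock_space_def fock_weight_def[abs_def])

lemma fock_norm_infinity: "fock_norm \<infinity> f = (SUP z. fock_weight f z)"
  by (simp add: fock_norm_def fock_weight_def[abs_def])

lemma fock_space_finite:
  "f \<in> fock_space (ereal q) \<longleftrightarrow>
    f holomorphic_on UNIV \<and> integrable lborel (\<lambda>z. fock_weight f z powr q)"
  by (simp add: fock_space_def fock_weight_powr)

lemma fock_norm_finite:
  "fock_norm (ereal q) f = (q / (2 * pi) * (LINT z|lborel. fock_weight f z powr q)) powr (1 / q)"
  by (simp add: fock_norm_def fock_weight_powr)

lemma exponent_cases:
  assumes "(1::ereal) \<le> p"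
  obtains "p = \<infinity>" | q where "p = ereal q" "1 \<le> q"
  using assms by (cases p) (auto simp: one_ereal_def)

lemma fock_space_holomorphic: "f \<in> fock_space p \<Longrightarrow> f holomorphic_on UNIV"
  by (simp add: fock_space_def)

lemma fock_norm_nonneg:
  assumes "1 \<le> p" "f \<in> fock_space p"
  shows "0 \<le> fock_norm p f"
  using assms(1)
proof (cases rule: exponent_cases)
  case 1
  have "fock_weight f 0 \<le> fock_norm p f"
    using assms 1 by (auto simp: fock_space_infinity fock_norm_infinity intro!: cSUP_upper)
  then show ?thesis using fock_weight_nonneg[of f 0] by linarith
next
  case (2 q)
  then show ?thesis by (simp add: fock_norm_finite)
qed

lemma fock_space_scale:
  assumes "1 \<le> p" "f \<in> fock_space p"
  shows "(\<lambda>z. c * f z) \<in> fock_space p" "fock_norm p (\<lambda>z. c * f z) = cmod c * fock_norm p f"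
proof -
  have h: "(\<lambda>z. c * f z) holomorphic_on UNIV"
    using fock_space_holomorphic[OF assms(2)] by (intro holomorphic_intros)
  show "(\<lambda>z. c * f z) \<in> fock_space p"
    using assms(1)
  proof (cases rule: exponent_cases)
    case 1
    then obtain M where "\<And>z. fock_weight f z \<le> M"
      using assms(2) by (auto simp: fock_space_infinity bdd_above_def)
    then have "fock_weight (\<lambda>z. c * f z) z \<le> cmod c * M" for z
      by (auto simp: fock_weight_scale intro!: mult_left_mono)
    then show ?thesis using h 1 by (auto simp: fock_space_infinity intro!: bdd_aboveI)
  next
    case (2 q)
    then show ?thesis using h assms(2)
      by (auto simp: fock_space_finite fock_weight_scale powr_mult)
  qed
  show "fock_norm p (\<lambda>z. c * f z) = cmod c * fock_norm p f"
    using assms(1)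
  proof (cases rule: exponent_cases)
    case 1
    show ?thesis
    proof (cases "c = 0")
      case True
      then show ?thesis using 1 by (simp add: fock_norm_infinity fock_weight_def)
    next
      case False
      have "(SUP z. cmod c * fock_weight f z) = cmod c * (SUP z. fock_weight f z)"
      proof (rule antisym)
        have b: "bdd_above (range (fock_weight f))" using assms(2) 1 by (simp add: fock_space_infinity)
        show "(SUP z. cmod c * fock_weight f z) \<le> cmod c * (SUP z. fock_weight f z)"
          using b by (intro cSUP_least mult_left_mono cSUP_upper) auto
        have b': "bdd_above (range (\<lambda>z. cmod c * fock_weight f z))"
        proof -
          obtain M where "\<And>z. fock_weight f z \<le> M" using b by (auto simp: bdd_above_def)
          then show ?thesis by (intro bdd_aboveI2[where M="cmod c * M"]) (simp add: mult_left_mono)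
        qed
        have "fock_weight f z \<le> (SUP z. cmod c * fock_weight f z) / cmod c" for z
          using cSUP_upper[OF _ b', of z] False by (simp add: field_simps)
        then have "(SUP z. fock_weight f z) \<le> (SUP z. cmod c * fock_weight f z) / cmod c"
          by (intro cSUP_least) auto
        then show "cmod c * (SUP z. fock_weight f z) \<le> (SUP z. cmod c * fock_weight f z)"
          using False by (simp add: field_simps)
      qed
      then show ?thesis using 1 by (simp add: fock_norm_infinity fock_weight_scale)
    qed
  next
    case (2 q)
    define J where "J = (LINT z|lborel. fock_weight f z powr q)"
    have J0: "0 \<le> J" unfolding J_def by (simp add: integral_nonneg_AE)
    have "fock_norm p (\<lambda>z. c * f z) = (q / (2 * pi) * (cmod c powr q * J)) powr (1 / q)"
      unfolding 2 fock_norm_finite J_def by (simp add: fock_weight_scale powr_mult)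
    also have "\<dots> = (cmod c powr q * (q / (2 * pi) * J)) powr (1 / q)"
      by (simp only: mult.left_commute)
    also have "\<dots> = (cmod c powr q) powr (1 / q) * (q / (2 * pi) * J) powr (1 / q)"
      using J0 2 by (subst powr_mult) auto
    also have "\<dots> = cmod c * fock_norm p f"
      using 2 by (simp add: powr_powr fock_norm_finite J_def)
    finally show ?thesis .
  qed
qed

text \<open>Compactness speaks of the norm of \<open>T (s n) - g\<close>, and point evaluation
  bounds apply only to members of the space. For finite \<open>q\<close> the bound by twice the
  maximum avoids Minkowski's inequality.\<close>

lemma fock_space_diff:
  assumes "1 \<le> p" and f: "f \<in> fock_space p" and g: "g \<in> fock_space p"
  shows "(\<lambda>z. f z - g z) \<in> fock_space p"
proof -
  have h: "(\<lambda>z. f z - g z) holomorphic_on UNIV"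
    using fock_space_holomorphic[OF f] fock_space_holomorphic[OF g] by (intro holomorphic_intros)
  have le: "fock_weight (\<lambda>z. f z - g z) z \<le> fock_weight f z + fock_weight g z" for z
    unfolding fock_weight_def by (simp flip: distrib_right add: mult_right_mono norm_triangle_ineq4)
  show ?thesis using assms(1)
  proof (cases rule: exponent_cases)
    case 1
    obtain M N where "\<And>z. fock_weight f z \<le> M" "\<And>z. fock_weight g z \<le> N"
      using f g 1 by (auto simp: fock_space_infinity bdd_above_def)
    then have "fock_weight (\<lambda>z. f z - g z) z \<le> M + N" for z
      using le[of z] by (smt (verit))
    then show ?thesis using 1 h by (auto simp: fock_space_infinity intro!: bdd_aboveI)
  next
    case (2 q)
    have "integrable lborel (\<lambda>z. fock_weight (\<lambda>z. f z - g z) z powr q)"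
    proof (rule Bochner_Integration.integrable_bound)
      show "integrable lborel (\<lambda>z. 2 powr q * (fock_weight f z powr q + fock_weight g z powr q))"
        using f g 2 by (auto simp: fock_space_finite)
      show "(\<lambda>z. fock_weight (\<lambda>z. f z - g z) z powr q) \<in> borel_measurable lborel"
        using fock_weight_measurable[OF h] by measurable
      show "AE z in lborel. norm (fock_weight (\<lambda>z. f z - g z) z powr q)
          \<le> norm (2 powr q * (fock_weight f z powr q + fock_weight g z powr q))"
      proof (intro AE_I2)
        fix z
        have "fock_weight (\<lambda>z. f z - g z) z \<le> 2 * max (fock_weight f z) (fock_weight g z)"
          using le[of z] by (simp add: max_def)
        then have "fock_weight (\<lambda>z. f z - g z) z powr q \<le> (2 * max (fock_weight f z) (fock_weight g z)) powr q"
          using 2 by (intro powr_mono2) auto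
        also have "\<dots> = 2 powr q * (max (fock_weight f z) (fock_weight g z)) powr q"
          by (simp add: powr_mult max_def)
        also have "\<dots> \<le> 2 powr q * (fock_weight f z powr q + fock_weight g z powr q)"
          by (intro mult_left_mono) (auto simp: max_def)
        finally show "norm (fock_weight (\<lambda>z. f z - g z) z powr q)
          \<le> norm (2 powr q * (fock_weight f z powr q + fock_weight g z powr q))" by simp
      qed
    qed
    then show ?thesis using 2 h by (simp add: fock_space_finite)
  qed
qed

text \<open>The disc mean inequality at the origin is applied to a Weyl translate of
  \<open>f\<close>. On the unit disc the Gaussian correction is at most \<open>exp (1/2)\<close>,
  and division by the disc area gives \<open>J / pi\<close>.\<close>

lemma fock_weight_le_of_integral_le:
  assumes f: "f holomorphic_on UNIV" and q: "1 \<le> q" and J: "0 \<le> J"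
    and I: "(\<integral>\<^sup>+z. ennreal (fock_weight f z powr q) \<partial>lborel) \<le> ennreal J"
  shows "fock_weight f w \<le> exp (1/2) * (1 + J / pi)"
proof -
  have [measurable]: "fock_weight f \<in> borel_measurable borel" by (rule fock_weight_measurable[OF f])
  have [measurable]: "(indicator (ball 0 1) :: complex \<Rightarrow> ennreal) \<in> borel_measurable borel"
    by (rule borel_measurable_indicator) simp
  \<comment> \<open>the Weyl translate of \<open>f\<close> that moves \<open>w\<close> to the origin: its weight at \<open>x\<close> is that of \<open>f\<close> at \<open>w + x\<close>\<close>
  define F where "F = (\<lambda>x. f (w + x) * exp (- cnj w * x - of_real ((cmod w)\<^sup>2 / 2)))"
  have hF: "F holomorphic_on UNIV"
    unfolding F_def
    by (intro holomorphic_intros holomorphic_on_compose_gen[OF _ f, unfolded o_def]) auto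
  have F: "cmod (F x) = fock_weight f (w + x) * exp ((cmod x)\<^sup>2 / 2)" for x
  proof -
    have "(cmod (w + x))\<^sup>2 = (cmod w)\<^sup>2 + 2 * Re (cnj w * x) + (cmod x)\<^sup>2"
      unfolding cmod_power2 by (simp add: power2_eq_square algebra_simps)
    then have "Re (- cnj w * x - of_real ((cmod w)\<^sup>2 / 2)) = - (cmod (w + x))\<^sup>2 / 2 + (cmod x)\<^sup>2 / 2"
      by (simp add: field_simps)
    then show ?thesis
      by (simp add: F_def fock_weight_def norm_mult norm_exp_eq_Re exp_add[symmetric])
  qed
  let ?B = "indicator (ball 0 1) :: complex \<Rightarrow> ennreal"
  have "ennreal (fock_weight f w * pi) = ennreal (cmod (F 0)) * emeasure lborel (ball (0::complex) 1)"
    by (simp add: F emeasure_ball unit_ball_vol_2 ennreal_mult)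
  also have "\<dots> \<le> (\<integral>\<^sup>+x. ?B x * ennreal (cmod (F x)) \<partial>lborel)"
    by (rule disc_mean_le[OF hF])
  also have "\<dots> \<le> (\<integral>\<^sup>+x. ennreal (exp (1/2)) * (?B x + ennreal (fock_weight f (w + x) powr q)) \<partial>lborel)"
  proof (intro nn_integral_mono)
    fix x
    show "?B x * ennreal (cmod (F x)) \<le> ennreal (exp (1/2)) * (?B x + ennreal (fock_weight f (w + x) powr q))"
    proof (cases "x \<in> ball 0 1")
      case True
      let ?t = "fock_weight f (w + x)"
      \<comment> \<open>A crude substitute for Hoelder's inequality. It loses homogeneity, which
        scaling restores in the point evaluation bound.\<close>
      have "?t \<le> 1 + ?t powr q"
      proof (cases "?t \<le> 1")
        case False
        then have "?t powr 1 \<le> ?t powr q" using q by (intro powr_mono) auto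
        then show ?thesis using False by simp
      qed (use powr_ge_zero[of ?t q] in linarith)
      moreover have "exp ((cmod x)\<^sup>2 / 2) \<le> exp (1/2)"
        using True by (simp add: power_le_one)
      ultimately have "cmod (F x) \<le> exp (1/2) * (1 + ?t powr q)"
        unfolding F by (subst mult.commute) (intro mult_mono, auto)
      then have "ennreal (cmod (F x)) \<le> ennreal (exp (1/2) * (1 + ?t powr q))" by (rule ennreal_leI)
      then show ?thesis using True by (simp add: ennreal_mult)
    qed simp
  qed
  also have "\<dots> = ennreal (exp (1/2)) * (emeasure lborel (ball (0::complex) 1) + (\<integral>\<^sup>+x. ennreal (fock_weight f (w + x) powr q) \<partial>lborel))"
    by (subst nn_integral_cmult) (auto simp: nn_integral_add)
  also have "(\<integral>\<^sup>+x. ennreal (fock_weight f (w + x) powr q) \<partial>lborel) = (\<integral>\<^sup>+x. ennreal (fock_weight f x powr q) \<partial>lborel)"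
    by (rule nn_integral_lborel_translate) measurable
  also have "ennreal (exp (1/2)) * (emeasure lborel (ball (0::complex) 1) + \<dots>) \<le> ennreal (exp (1/2)) * (ennreal pi + ennreal J)"
    using I by (intro mult_left_mono add_mono) (auto simp: emeasure_ball unit_ball_vol_2)
  also have "\<dots> = ennreal (exp (1/2) * (pi + J))"
    using J by (simp add: ennreal_mult)
  finally have "fock_weight f w * pi \<le> exp (1/2) * (pi + J)"
    using J by (subst (asm) ennreal_le_iff) auto
  then show ?thesis by (simp add: field_simps)
qed

proposition fock_point_evaluation:
  assumes p: "1 \<le> p"
  obtains K where "0 \<le> K" "\<And>f z. f \<in> fock_space p \<Longrightarrow> fock_weight f z \<le> K * fock_norm p f"
proof -
  \<comment> \<open>The factor is \<open>1 + 2\<close>: norm at most 1 gives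
    \<open>q * J \<le> 2 * pi\<close>, hence \<open>J / pi \<le> 2\<close> for every
    \<open>q \<ge> 1\<close>.\<close>
  define K :: real where "K = exp (1/2) * 3"
  have K1: "1 \<le> K" unfolding K_def using one_le_exp_iff[of "1/2 :: real"] by linarith
  have unit: "fock_weight f z \<le> K" if f: "f \<in> fock_space p" and n: "fock_norm p f \<le> 1" for f z
    using p
  proof (cases rule: exponent_cases)
    case 1
    then have "fock_weight f z \<le> fock_norm p f"
      using f by (auto simp: fock_space_infinity fock_norm_infinity intro!: cSUP_upper)
    then show ?thesis using n K1 by linarith
  next
    case (2 q)
    define J where "J = (LINT z|lborel. fock_weight f z powr q)"
    have J0: "0 \<le> J" unfolding J_def by (simp add: integral_nonneg_AE)
    have "q / (2 * pi) * J \<le> 1"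
    proof (rule ccontr)
      assume "\<not> q / (2 * pi) * J \<le> 1"
      then have "1 < (q / (2 * pi) * J) powr (1 / q)"
        using 2 by (intro gr_one_powr) auto
      then show False using n 2 by (simp add: fock_norm_finite J_def)
    qed
    then have "q * J \<le> 2 * pi" by (simp add: field_simps)
    moreover have "J \<le> q * J" using 2 J0 by (simp add: mult_le_cancel_right1)
    ultimately have J2: "J / pi \<le> 2" by (simp add: field_simps)
    have "(\<integral>\<^sup>+z. ennreal (fock_weight f z powr q) \<partial>lborel) = ennreal J"
      unfolding J_def using f 2 by (intro nn_integral_eq_integral) (auto simp: fock_space_finite)
    then have "fock_weight f z \<le> exp (1/2) * (1 + J / pi)"
      using f 2 J0 by (intro fock_weight_le_of_integral_le[of f q]) (auto simp: fock_space_holomorphic)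
    also have "\<dots> \<le> K" unfolding K_def using J2 by (intro mult_left_mono) auto
    finally show ?thesis .
  qed
  have "fock_weight f z \<le> K * fock_norm p f" if f: "f \<in> fock_space p" for f z
  proof -
    \<comment> \<open>Dividing by some \<open>t\<close> strictly above the norm, instead of by the
      norm itself, avoids a separate case for norm zero; \<open>t\<close> then decreases to the
      norm.\<close>
    have *: "fock_weight f z \<le> K * t" if t: "fock_norm p f < t" for t
    proof -
      have t0: "0 < t" using t fock_norm_nonneg[OF p f] by linarith
      have "fock_weight (\<lambda>z. of_real (1/t) * f z) z \<le> K"
        using t t0 by (intro unit fock_space_scale[OF p f]) (subst fock_space_scale[OF p f], simp add: norm_divide)
      then show ?thesis using t0 by (subst (asm) fock_weight_scale) (simp add: norm_divide field_simps)
    qed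
    have "fock_weight f z / K \<le> fock_norm p f"
      by (rule dense_ge) (use * K1 in \<open>auto simp: field_simps\<close>)
    then show ?thesis using K1 by (simp add: field_simps)
  qed
  with K1 show ?thesis by (intro that[of K]) auto
qed

text \<open>The constant depends only on \<open>p\<close> and \<open>d\<close>. Its uniformity in
  the centre \<open>c\<close> comes from translation invariance of area, and its uniformity in
  \<open>f\<close> serves all kernels and all powers of the operator at once.\<close>

proposition fock_gaussian_domination:
  assumes p: "1 \<le> p" and d: "0 < d"
  obtains C where "0 \<le> C"
    "\<And>f c A. f holomorphic_on UNIV \<Longrightarrow> 0 \<le> A \<Longrightarrow>
       (\<And>z. fock_weight f z \<le> A * exp (- d * (cmod (z - c))\<^sup>2)) \<Longrightarrow>
       f \<in> fock_space p \<and> fock_norm p f \<le> C * A"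
  using p
proof (cases rule: exponent_cases)
  case 1
  have "f \<in> fock_space p \<and> fock_norm p f \<le> 1 * A"
    if f: "f holomorphic_on UNIV" and A: "0 \<le> A"
      and b: "\<And>z. fock_weight f z \<le> A * exp (- d * (cmod (z - c))\<^sup>2)" for f c A
  proof -
    have "fock_weight f z \<le> A" for z
      by (rule order_trans[OF b]) (use A d in \<open>auto intro!: mult_left_le\<close>)
    then show ?thesis using f 1
      by (auto simp: fock_space_infinity fock_norm_infinity intro!: bdd_aboveI cSUP_least)
  qed
  then show ?thesis by (intro that[of 1]) auto
next
  case (2 q)
  define G where "G = (LINT z|lborel. exp (- (d * q) * (cmod (z - 0 :: complex))\<^sup>2))"
  have G0: "0 \<le> G" unfolding G_def by (simp add: integral_nonneg_AE)
  have "f \<in> fock_space p \<and> fock_norm p f \<le> (q / (2 * pi) * G) powr (1 / q) * A"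
    if f: "f holomorphic_on UNIV" and A: "0 \<le> A"
      and b: "\<And>z. fock_weight f z \<le> A * exp (- d * (cmod (z - c))\<^sup>2)" for f c A
  proof -
    have le: "fock_weight f z powr q \<le> A powr q * exp (- (d * q) * (cmod (z - c))\<^sup>2)" for z
    proof -
      have "fock_weight f z powr q \<le> (A * exp (- d * (cmod (z - c))\<^sup>2)) powr q"
        using b 2 by (intro powr_mono2) auto
      also have "\<dots> = A powr q * exp (- (d * q) * (cmod (z - c))\<^sup>2)"
        using A by (simp add: powr_mult exp_powr_real mult_ac)
      finally show ?thesis .
    qed
    have int: "integrable lborel (\<lambda>z. A powr q * exp (- (d * q) * (cmod (z - c))\<^sup>2))"
      using gaussian_integrable_complex[of "d * q" c] d 2 by (intro integrable_mult_right) auto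
    have fi: "integrable lborel (\<lambda>z. fock_weight f z powr q)"
    proof (rule Bochner_Integration.integrable_bound[OF int])
      show "(\<lambda>z. fock_weight f z powr q) \<in> borel_measurable lborel"
        using fock_weight_measurable[OF f] by measurable
      show "AE z in lborel. norm (fock_weight f z powr q) \<le> norm (A powr q * exp (- (d * q) * (cmod (z - c))\<^sup>2))"
        using le by (intro AE_I2) (simp add: abs_mult)
    qed
    have Gc: "(LINT z|lborel. exp (- (d * q) * (cmod (z - c))\<^sup>2)) = G"
    proof -
      have "ennreal (LINT z|lborel. exp (- (d * q) * (cmod (z - c))\<^sup>2)) = (\<integral>\<^sup>+z. ennreal (exp (- (d * q) * (cmod (z - c))\<^sup>2)) \<partial>lborel)"
        using gaussian_integrable_complex[of "d * q" c] d 2 by (intro nn_integral_eq_integral[symmetric]) auto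
      also have "\<dots> = (\<integral>\<^sup>+z. ennreal (exp (- (d * q) * (cmod (z - 0 :: complex))\<^sup>2)) \<partial>lborel)"
        using nn_integral_lborel_translate[where c="-c" and f="\<lambda>z. ennreal (exp (- (d * q) * (cmod z)\<^sup>2))"] by simp
      also have "\<dots> = ennreal G"
        unfolding G_def using gaussian_integrable_complex[of "d * q" 0] d 2 by (intro nn_integral_eq_integral) auto
      finally show ?thesis using G0 by (subst (asm) ennreal_inj) (auto intro!: integral_nonneg_AE)
    qed
    have "(LINT z|lborel. fock_weight f z powr q) \<le> (LINT z|lborel. A powr q * exp (- (d * q) * (cmod (z - c))\<^sup>2))"
      using fi int le by (intro integral_mono) auto
    also have "\<dots> = A powr q * G" using Gc by simp
    finally have "q / (2 * pi) * (LINT z|lborel. fock_weight f z powr q) \<le> q / (2 * pi) * (A powr q * G)"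
      using 2 by (intro mult_left_mono) auto
    then have "fock_norm p f \<le> (q / (2 * pi) * (A powr q * G)) powr (1 / q)"
      unfolding 2 fock_norm_finite using 2 by (intro powr_mono2) (auto intro!: mult_nonneg_nonneg integral_nonneg_AE)
    also have "\<dots> = ((q / (2 * pi) * G) * A powr q) powr (1 / q)" by (simp add: mult_ac)
    also have "\<dots> = (q / (2 * pi) * G) powr (1 / q) * A"
      using 2 A G0 by (subst powr_mult) (auto simp: powr_powr)
    finally show ?thesis using f fi 2 by (auto simp: fock_space_finite)
  qed
  then show ?thesis by (rule that[OF powr_ge_zero])
qed

section \<open>Entire functions whose real part is quadratically bounded\<close>

text \<open>The Borel--Caratheodory inequality: apply the Schwarz lemma to \<open>f / (2 M - f)\<close>.\<close>
lemma holomorphic_Re_bound_imp_norm_bound: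
  assumes f: "f holomorphic_on UNIV" and f0: "f 0 = 0" and M: "0 < M"
    and le: "\<And>z. cmod z < R \<Longrightarrow> Re (f z) < M" and z: "cmod z < R"
  shows "cmod (f z) * (R - cmod z) \<le> 2 * M * cmod z"
proof -
  have R: "0 < R" using z norm_ge_zero[of z] by linarith
  define g where "g = (\<lambda>w. f (of_real R * w) / (2 * of_real M - f (of_real R * w)))"
  have in_disc: "cmod (of_real R * w) < R" if "cmod w < 1" for w
    using that R by (simp add: norm_mult)
  have nz: "2 * of_real M - f (of_real R * w) \<noteq> 0" if "cmod w < 1" for w
  proof
    assume "2 * of_real M - f (of_real R * w) = 0"
    then have "Re (f (of_real R * w)) = 2 * M" by (metis eq_iff_diff_eq_0 Re_complex_of_real of_real_mult of_real_numeral)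
    then show False using le[OF in_disc[OF that]] M by linarith
  qed
  have "g holomorphic_on ball 0 1"
    unfolding g_def using nz
    by (intro holomorphic_intros holomorphic_on_compose_gen[OF _ f, unfolded o_def]) auto
  moreover have "cmod (g w) < 1" if w: "cmod w < 1" for w
  proof -
    let ?v = "f (of_real R * w)"
    have "(cmod ?v)\<^sup>2 < (cmod (2 * of_real M - ?v))\<^sup>2"
    proof -
      \<comment> \<open>The map \<open>v / (2 * M - v)\<close> sends the half-plane
        \<open>Re v < M\<close> into the unit disc; this identity is the reason.\<close>
      have "(cmod (2 * of_real M - ?v))\<^sup>2 = (cmod ?v)\<^sup>2 + 4 * M * (M - Re ?v)"
        unfolding cmod_power2 by (simp add: power2_eq_square algebra_simps)
      moreover have "0 < 4 * M * (M - Re ?v)" using le[OF in_disc[OF w]] M by simp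
      ultimately show ?thesis by linarith
    qed
    then have "cmod ?v < cmod (2 * of_real M - ?v)" by (rule power2_less_imp_less) simp
    then show ?thesis using nz[OF w] by (simp add: g_def norm_divide)
  qed
  ultimately have "cmod (g (z / of_real R)) \<le> cmod (z / of_real R)"
    using z R by (intro Schwarz_Lemma(1)) (auto simp: g_def f0 norm_divide)
  then have "cmod (f z) / cmod (2 * of_real M - f z) \<le> cmod z / R"
    using R by (simp add: g_def norm_divide)
  moreover have "2 * of_real M - f z \<noteq> 0" using nz[of "z / of_real R"] z R by (simp add: norm_divide)
  ultimately have "cmod (f z) * R \<le> cmod z * cmod (2 * of_real M - f z)"
    using R by (simp add: field_simps)
  also have "\<dots> \<le> cmod z * (2 * M + cmod (f z))"
    using M norm_triangle_ineq4[of "2 * of_real M" "f z"] by (intro mult_left_mono) (auto simp: norm_mult)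
  finally show ?thesis by (simp add: algebra_simps)
qed

text \<open>Borel--Caratheodory turns the one-sided bound on the real part into quadratic growth of
  the modulus, and Liouville's theorem for polynomial growth finishes.\<close>

lemma holomorphic_Re_le_quadratic_imp_quadratic:
  assumes q: "q holomorphic_on UNIV" and le: "\<And>z. Re (q z) \<le> A + B * (cmod z)\<^sup>2"
  obtains c0 c1 c2 where "\<And>z. q z = c0 + c1 * z + c2 * z\<^sup>2"
proof -
  define f where "f = (\<lambda>z. q z - q 0)"
  \<comment> \<open>Chosen so that \<open>D * (2 * r)^2\<close> exceeds \<open>Re (f w)\<close> on
    the disc of radius \<open>2 * r\<close> when \<open>r \<ge> 1\<close>; the summand 1 makes the
    inequality strict.\<close>
  define D where "D = \<bar>A\<bar> + cmod (q 0) + 1 + \<bar>B\<bar>"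
  have hf: "f holomorphic_on UNIV" unfolding f_def using q by (intro holomorphic_intros)
  have D: "0 < D" unfolding D_def using norm_ge_zero[of "q 0"] by linarith
  have bd: "cmod (f z) \<le> (8 * D) * cmod z ^ 2" if z: "1 \<le> cmod z" for z
  proof -
    define r where "r = cmod z"
    define M where "M = D * (2 * r)\<^sup>2"
    have r: "1 \<le> r" using z by (simp add: r_def)
    have M0: "0 < M" using D r by (simp add: M_def)
    have "Re (f w) < M" if w: "cmod w < 2 * r" for w
    proof -
      have "1 \<le> (2 * r)\<^sup>2" using r by (intro one_le_power) auto
      then have "(\<bar>A\<bar> + cmod (q 0) + 1) * 1 \<le> (\<bar>A\<bar> + cmod (q 0) + 1) * (2 * r)\<^sup>2"
        by (intro mult_left_mono) auto
      moreover have "B * (cmod w)\<^sup>2 \<le> \<bar>B\<bar> * (2 * r)\<^sup>2"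
        using w by (intro mult_mono power_mono) auto
      moreover have "Re (f w) \<le> A + B * (cmod w)\<^sup>2 + cmod (q 0)"
        using le[of w] abs_Re_le_cmod[of "q 0"] by (simp add: f_def)
      ultimately show ?thesis unfolding M_def D_def by (simp add: distrib_right)
    qed
    \<comment> \<open>Radius \<open>2 * r\<close> leaves the gap \<open>r\<close> on the left, which
      cancels against \<open>cmod z\<close> on the right.\<close>
    then have "cmod (f z) * (2 * r - cmod z) \<le> 2 * M * cmod z"
      using r by (intro holomorphic_Re_bound_imp_norm_bound[OF hf _ M0]) (auto simp: f_def r_def)
    then have "cmod (f z) * r \<le> (8 * D * r\<^sup>2) * r"
      by (simp add: r_def M_def power_mult_distrib algebra_simps)
    moreover have "0 < r" using r by simp
    ultimately have "cmod (f z) \<le> 8 * D * r\<^sup>2" by (rule mult_right_le_imp_le)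
    then show ?thesis by (simp add: r_def)
  qed
  from Liouville_polynomial[OF hf bd]
  have fz: "f z = (\<Sum>k\<le>2. (deriv ^^ k) f 0 / fact k * z ^ k)" for z by blast
  have "q z = (q 0 + f 0) + (deriv ^^ 1) f 0 * z + (deriv ^^ 2) f 0 / 2 * z\<^sup>2" for z
  proof -
    have "q z = q 0 + f z" by (simp add: f_def)
    then show ?thesis by (simp add: fz[of z] numeral_2_eq_2)
  qed
  then show ?thesis by (rule that)
qed

section \<open>Weighted composition operators\<close>

text \<open>The reproducing kernel \<open>exp (cnj w * z)\<close> divided by
  \<open>exp ((cmod w)^2 / 2)\<close>. With this normalisation its weight is a Gaussian with peak
  value 1 at \<open>w\<close>.\<close>

definition fock_kernel :: "complex \<Rightarrow> complex \<Rightarrow> complex" where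
  "fock_kernel w z = exp (cnj w * z - of_real ((cmod w)\<^sup>2 / 2))"

lemma fock_weight_kernel: "fock_weight (fock_kernel w) z = exp (- (cmod (z - w))\<^sup>2 / 2)"
proof -
  have "(cmod (z - w))\<^sup>2 = (cmod z)\<^sup>2 - 2 * Re (cnj w * z) + (cmod w)\<^sup>2"
    unfolding cmod_power2 by (simp add: power2_eq_square algebra_simps)
  then have "Re (cnj w * z - of_real ((cmod w)\<^sup>2 / 2)) + - (cmod z)\<^sup>2 / 2 = - (cmod (z - w))\<^sup>2 / 2"
    by (simp add: field_simps)
  then show ?thesis
    unfolding fock_weight_def fock_kernel_def norm_exp_eq_Re by (simp flip: exp_add)
qed

lemma fock_kernel_zero: "fock_kernel 0 = (\<lambda>_. 1)"
  by (simp add: fock_kernel_def[abs_def])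

lemma fock_kernel_holomorphic: "fock_kernel w holomorphic_on UNIV"
  unfolding fock_kernel_def by (intro holomorphic_intros)

text \<open>The weights of all kernels are translates of one Gaussian, so Gaussian domination with
  centre \<open>w\<close> bounds them uniformly.\<close>

lemma fock_kernel_bounded:
  assumes "1 \<le> p"
  obtains C where "\<And>w. fock_kernel w \<in> fock_space p" "\<And>w. fock_norm p (fock_kernel w) \<le> C"
proof -
  have half: "(0::real) < 1/2" by simp
  obtain C where C: "\<And>f c A. f holomorphic_on UNIV \<Longrightarrow> 0 \<le> A \<Longrightarrow>
       (\<And>z. fock_weight f z \<le> A * exp (- (1/2) * (cmod (z - c))\<^sup>2)) \<Longrightarrow>
       f \<in> fock_space p \<and> fock_norm p f \<le> C * A"
    using fock_gaussian_domination[OF assms half] by blast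
  have "fock_kernel w \<in> fock_space p \<and> fock_norm p (fock_kernel w) \<le> C * 1" for w
    by (rule C[where c=w]) (auto simp: fock_kernel_holomorphic fock_weight_kernel)
  then show ?thesis by (intro that[of "C * 1"]) auto
qed

section \<open>The multiplier: boundedness and decay\<close>

definition comp_multiplier :: "(complex \<Rightarrow> complex) \<Rightarrow> (complex \<Rightarrow> complex) \<Rightarrow> complex \<Rightarrow> real" where
  "comp_multiplier u \<psi> z = cmod (u z) * exp (((cmod (\<psi> z))\<^sup>2 - (cmod z)\<^sup>2) / 2)"

lemma comp_multiplier_nonneg [simp]: "0 \<le> comp_multiplier u \<psi> z"
  by (simp add: comp_multiplier_def)

lemma fock_weight_weighted_comp:
  "fock_weight (weighted_comp u \<psi> f) z = comp_multiplier u \<psi> z * fock_weight f (\<psi> z)"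
proof -
  have "exp (- (cmod z)\<^sup>2 / 2) = exp (((cmod (\<psi> z))\<^sup>2 - (cmod z)\<^sup>2) / 2) * exp (- (cmod (\<psi> z))\<^sup>2 / 2)"
    unfolding exp_add[symmetric] by (simp add: field_simps)
  then show ?thesis
    by (simp add: fock_weight_def comp_multiplier_def weighted_comp_def norm_mult)
qed

lemma fock_weight_weighted_comp_funpow:
  "fock_weight ((weighted_comp u \<psi> ^^ n) f) z =
    (\<Prod>j<n. comp_multiplier u \<psi> ((\<psi> ^^ j) z)) * fock_weight f ((\<psi> ^^ n) z)"
proof (induction n arbitrary: z)
  case (Suc n)
  have "fock_weight ((weighted_comp u \<psi> ^^ Suc n) f) z = comp_multiplier u \<psi> z *
      ((\<Prod>j<n. comp_multiplier u \<psi> ((\<psi> ^^ j) (\<psi> z))) * fock_weight f ((\<psi> ^^ n) (\<psi> z)))"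
    by (simp add: fock_weight_weighted_comp Suc.IH)
  then show ?case
    by (simp add: prod.lessThan_Suc_shift funpow_swap1 mult.assoc del: prod.lessThan_Suc funpow.simps(2))
       (simp add: funpow_swap1)
qed simp

lemma weighted_comp_funpow:
  "(weighted_comp u \<psi> ^^ n) f = (\<lambda>z. weight_iter u \<psi> n z * f ((\<psi> ^^ n) z))"
proof (induction n)
  case (Suc n)
  have "(weighted_comp u \<psi> ^^ Suc n) f = weighted_comp u \<psi> (\<lambda>z. weight_iter u \<psi> n z * f ((\<psi> ^^ n) z))"
    by (simp add: Suc.IH)
  also have "\<dots> = (\<lambda>z. weight_iter u \<psi> (Suc n) z * f ((\<psi> ^^ Suc n) z))"
    by (simp add: weighted_comp_def weight_iter_def prod.lessThan_Suc_shift funpow_swap1 mult.assoc del: prod.lessThan_Suc)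
  finally show ?case .
qed (simp add: weight_iter_def)

text \<open>The kernel at \<open>\<psi> z\<close> has weight 1 at \<open>\<psi> z\<close>, so the
  weight of its image at \<open>z\<close> is exactly the multiplier. Point evaluation and
  boundedness of the operator control it.\<close>

lemma comp_multiplier_bounded:
  assumes p: "1 \<le> p"
    and T: "bounded_operator_on (fock_space p) (fock_norm p) (weighted_comp u \<psi>)"
  obtains B where "0 < B" "\<And>z. comp_multiplier u \<psi> z \<le> B"
proof -
  obtain K where K: "0 \<le> K" "\<And>f z. f \<in> fock_space p \<Longrightarrow> fock_weight f z \<le> K * fock_norm p f"
    using fock_point_evaluation[OF p] by blast
  obtain C where C: "\<And>w. fock_kernel w \<in> fock_space p" "\<And>w. fock_norm p (fock_kernel w) \<le> C"
    using fock_kernel_bounded[OF p] by blast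
  obtain D where D: "\<And>f. f \<in> fock_space p \<Longrightarrow> fock_norm p (weighted_comp u \<psi> f) \<le> D * fock_norm p f"
    and V: "\<And>f. f \<in> fock_space p \<Longrightarrow> weighted_comp u \<psi> f \<in> fock_space p"
    using T unfolding bounded_operator_on_def by blast
  \<comment> \<open>The constant \<open>D\<close> may be negative, hence the absolute value. The
    summand 1 makes the bound positive, so that its logarithm can be used.\<close>
  have "comp_multiplier u \<psi> z \<le> K * (\<bar>D\<bar> * C) + 1" for z
  proof -
    let ?k = "fock_kernel (\<psi> z)"
    have "comp_multiplier u \<psi> z = fock_weight (weighted_comp u \<psi> ?k) z"
      by (simp add: fock_weight_weighted_comp fock_weight_kernel)
    also have "\<dots> \<le> K * fock_norm p (weighted_comp u \<psi> ?k)" by (intro K V C)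
    also have "\<dots> \<le> K * (\<bar>D\<bar> * C)"
    proof (rule mult_left_mono[OF _ K(1)])
      have "fock_norm p (weighted_comp u \<psi> ?k) \<le> D * fock_norm p ?k" by (intro D C)
      also have "\<dots> \<le> \<bar>D\<bar> * C"
        by (intro mult_mono C fock_norm_nonneg[OF p]) auto
      finally show "fock_norm p (weighted_comp u \<psi> ?k) \<le> \<bar>D\<bar> * C" .
    qed
    finally show ?thesis by simp
  qed
  moreover have "0 < K * (\<bar>D\<bar> * C) + 1"
    using K(1) C(2)[of 0] fock_norm_nonneg[OF p C(1)[of 0]]
    by (intro add_nonneg_pos mult_nonneg_nonneg) auto
  ultimately show ?thesis by (rule that[rotated])
qed

text \<open>The kernels at \<open>\<psi> (x n)\<close> tend to \<open>0\<close> pointwise, so compactness forces their images to tend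
  to \<open>0\<close> in norm along a subsequence.\<close>
lemma comp_multiplier_vanishes_at_infinity:
  fixes x :: "nat \<Rightarrow> complex"
  assumes p: "1 \<le> p"
    and T: "compact_operator_on (fock_space p) (fock_norm p) (weighted_comp u \<psi>)"
    and x: "filterlim (\<lambda>n. \<psi> (x n)) at_infinity sequentially"
  obtains r where "strict_mono (r :: nat \<Rightarrow> nat)" "(\<lambda>n. comp_multiplier u \<psi> (x (r n))) \<longlonglongrightarrow> 0"
proof -
  let ?T = "weighted_comp u \<psi>"
  obtain K where K: "0 \<le> K" "\<And>f z. f \<in> fock_space p \<Longrightarrow> fock_weight f z \<le> K * fock_norm p f"
    using fock_point_evaluation[OF p] by blast
  obtain C where C: "\<And>w. fock_kernel w \<in> fock_space p" "\<And>w. fock_norm p (fock_kernel w) \<le> C"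
    using fock_kernel_bounded[OF p] by blast
  define s where "s = (\<lambda>n. fock_kernel (\<psi> (x n)))"
  obtain g r where g: "g \<in> fock_space p" and r: "strict_mono (r :: nat \<Rightarrow> nat)"
    and lim: "(\<lambda>n. fock_norm p (\<lambda>z. ?T (s (r n)) z - g z)) \<longlonglongrightarrow> 0"
    using T C unfolding compact_operator_on_def s_def by meson
  have V: "f \<in> fock_space p \<Longrightarrow> ?T f \<in> fock_space p" for f
    using T unfolding compact_operator_on_def bounded_operator_on_def by blast
  have Kn: "fock_weight (\<lambda>z. ?T (s (r n)) z - g z) z \<le> K * fock_norm p (\<lambda>z. ?T (s (r n)) z - g z)" for n z
    by (intro K fock_space_diff[OF p] V g) (simp add: s_def C)
  have lim': "(\<lambda>n. K * fock_norm p (\<lambda>z. ?T (s (r n)) z - g z)) \<longlonglongrightarrow> 0"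
    using tendsto_mult_right_zero[OF lim] .
  \<comment> \<open>Norm convergence implies pointwise convergence to \<open>g\<close>, while the
    images of the kernels tend to 0 at each fixed \<open>z\<close> because their centres escape to
    infinity.\<close>
  have g0: "g z = 0" for z
  proof -
    have "filterlim (\<lambda>n. \<psi> (x (r n))) at_infinity sequentially"
      using filterlim_compose[OF x filterlim_subseq[OF r]] .
    then have "filterlim (\<lambda>n. cmod (\<psi> (x (r n)))) at_top sequentially"
      by (rule filterlim_compose[OF filterlim_norm_at_top])
    then have "filterlim (\<lambda>n. - cmod (\<psi> z) + cmod (\<psi> (x (r n)))) at_top sequentially"
      by (rule filterlim_tendsto_add_at_top[OF tendsto_const])
    then have "filterlim (\<lambda>n. cmod (\<psi> z - \<psi> (x (r n)))) at_top sequentially"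
    proof (rule filterlim_at_top_mono, intro always_eventually allI)
      show "- cmod (\<psi> z) + cmod (\<psi> (x (r n))) \<le> cmod (\<psi> z - \<psi> (x (r n)))" for n
        using norm_triangle_ineq2[of "\<psi> (x (r n))" "\<psi> z"] by (simp add: norm_minus_commute)
    qed
    then have "filterlim (\<lambda>n. (cmod (\<psi> z - \<psi> (x (r n))))\<^sup>2) at_top sequentially"
      by (intro filterlim_pow_at_top) auto
    then have "filterlim (\<lambda>n. (1/2) * (cmod (\<psi> z - \<psi> (x (r n))))\<^sup>2) at_top sequentially"
      by (intro filterlim_tendsto_pos_mult_at_top[OF tendsto_const]) auto
    then have "(\<lambda>n. exp (- ((1/2) * (cmod (\<psi> z - \<psi> (x (r n))))\<^sup>2))) \<longlonglongrightarrow> 0"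
      by (intro filterlim_compose[OF exp_at_bot] filterlim_compose[OF filterlim_uminus_at_bot_at_top])
    then have "(\<lambda>n. comp_multiplier u \<psi> z * exp (- ((1/2) * (cmod (\<psi> z - \<psi> (x (r n))))\<^sup>2))) \<longlonglongrightarrow> 0"
      by (rule tendsto_mult_right_zero)
    moreover have "fock_weight (?T (s (r n))) z = comp_multiplier u \<psi> z * exp (- ((1/2) * (cmod (\<psi> z - \<psi> (x (r n))))\<^sup>2))" for n
      by (simp add: fock_weight_weighted_comp s_def fock_weight_kernel)
    ultimately have "(\<lambda>n. fock_weight (?T (s (r n))) z) \<longlonglongrightarrow> 0" by simp
    from tendsto_add[OF this lim'] have sum0: "(\<lambda>n. fock_weight (?T (s (r n))) z + K * fock_norm p (\<lambda>z. ?T (s (r n)) z - g z)) \<longlonglongrightarrow> 0"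
      by simp
    have le: "fock_weight g z \<le> fock_weight (?T (s (r n))) z + K * fock_norm p (\<lambda>z. ?T (s (r n)) z - g z)" for n
    proof -
      let ?v = "?T (s (r n)) z"
      have "cmod (g z) \<le> cmod ?v + cmod (?v - g z)"
        using norm_triangle_ineq4[of ?v "?v - g z"] by simp
      then have "cmod (g z) * exp (- (cmod z)\<^sup>2 / 2) \<le> (cmod ?v + cmod (?v - g z)) * exp (- (cmod z)\<^sup>2 / 2)"
        by (rule mult_right_mono) simp
      then have "fock_weight g z \<le> fock_weight (?T (s (r n))) z + fock_weight (\<lambda>z. ?T (s (r n)) z - g z) z"
        by (simp add: fock_weight_def distrib_right)
      then show ?thesis using Kn[of n z] by linarith
    qed
    have "fock_weight g z \<le> 0"
      by (rule tendsto_lowerbound[OF sum0]) (use le in auto)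
    then show ?thesis by (simp add: fock_weight_def mult_le_0_iff)
  qed
  have "(\<lambda>n. comp_multiplier u \<psi> (x (r n))) \<longlonglongrightarrow> 0"
  proof (rule tendsto_sandwich[OF _ _ tendsto_const lim'])
    show "\<forall>\<^sub>F n in sequentially. comp_multiplier u \<psi> (x (r n)) \<le> K * fock_norm p (\<lambda>z. ?T (s (r n)) z - g z)"
    proof (intro always_eventually allI)
      fix n
      \<comment> \<open>The point \<open>x (r n)\<close> is mapped to the peak of its own kernel,
        where the weight is 1.\<close>
      have "comp_multiplier u \<psi> (x (r n)) = fock_weight (\<lambda>z. ?T (s (r n)) z - g z) (x (r n))"
        by (simp add: g0 fock_weight_weighted_comp[unfolded weighted_comp_def] weighted_comp_def s_def fock_weight_kernel)
      then show "comp_multiplier u \<psi> (x (r n)) \<le> K * fock_norm p (\<lambda>z. ?T (s (r n)) z - g z)"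
        using Kn by simp
    qed
  qed simp
  with r show ?thesis by (rule that)
qed

section \<open>Affine symbols, centred at the fixed point\<close>

lemma affine_funpow:
  fixes a b :: complex
  assumes "\<And>z. \<psi> z = a * z + b" "a \<noteq> 1"
  shows "(\<psi> ^^ n) (b / (1 - a) + x) = b / (1 - a) + a ^ n * x"
proof (induction n)
  case (Suc n)
  have "a * (b / (1 - a)) + b = b / (1 - a)" using assms(2) by (simp add: field_simps)
  moreover have "(\<psi> ^^ Suc n) (b / (1 - a) + x) = a * (b / (1 - a) + a ^ n * x) + b"
    by (simp only: funpow.simps comp_apply Suc.IH assms(1))
  ultimately show ?case by (simp only: distrib_left power_Suc mult.assoc) (metis add.commute add.left_commute)
qed simp

text \<open>Expanded about the fixed point, the exponent is a linear term plus
  \<open>Re (c2 * x^2) - \<kappa> * (cmod x)^2\<close>. Decay at infinity forces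
  \<open>cmod c2 < \<kappa>\<close>, which leaves a genuine Gaussian. Here
  \<open>a \<noteq> 0\<close> ensures that \<open>\<psi> x\<close> escapes to infinity with
  \<open>x\<close>.\<close>

proposition comp_multiplier_gaussian_decay:
  assumes p: "1 \<le> p" and u: "u holomorphic_on UNIV" "\<And>z. u z \<noteq> 0"
    and \<psi>: "\<And>z. \<psi> z = a * z + b" and a: "cmod a < 1" "a \<noteq> 0"
    and T: "compact_operator_on (fock_space p) (fock_norm p) (weighted_comp u \<psi>)"
  defines "z0 \<equiv> b / (1 - a)"
  obtains L \<epsilon> where "0 \<le> L" "0 < \<epsilon>"
    "\<And>x. comp_multiplier u \<psi> (z0 + x) \<le> cmod (u z0) * exp (L * cmod x - \<epsilon> * (cmod x)\<^sup>2)"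
proof -
  have bT: "bounded_operator_on (fock_space p) (fock_norm p) (weighted_comp u \<psi>)"
    using T by (simp add: compact_operator_on_def)
  obtain B where B: "0 < B" "\<And>z. comp_multiplier u \<psi> z \<le> B"
    using comp_multiplier_bounded[OF p bT] by blast
  obtain q where q: "q holomorphic_on UNIV" "\<And>z. exp (q z) = u z"
    using holomorphic_logarithm_exists[OF convex_UNIV open_UNIV u(1)] u(2) by (metis UNIV_I)
  have mult: "comp_multiplier u \<psi> z = exp (Re (q z) + ((cmod (\<psi> z))\<^sup>2 - (cmod z)\<^sup>2) / 2)" for z
    by (simp add: comp_multiplier_def exp_add flip: q(2))
  have "Re (q z) \<le> ln B + 1 / 2 * (cmod z)\<^sup>2" for z
  proof -
    have "Re (q z) + ((cmod (\<psi> z))\<^sup>2 - (cmod z)\<^sup>2) / 2 \<le> ln B"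
      using B(2)[of z] B(1) unfolding mult by (simp add: ln_ge_iff)
    moreover have "r \<le> l + 1 / 2 * t" if "r + (s - t) / 2 \<le> l" "0 \<le> s" for r s t l :: real
      using that by (simp add: field_simps)
    ultimately show ?thesis by simp
  qed
  from holomorphic_Re_le_quadratic_imp_quadratic[OF q(1) this]
  obtain c0 c1 c2 where c: "\<And>z. q z = c0 + c1 * z + c2 * z\<^sup>2" by blast
  \<comment> \<open>The linear coefficient at \<open>z0\<close>: the derivative of \<open>q\<close>
    there plus the cross term of \<open>(cmod (\<psi> z))^2 - (cmod z)^2\<close>.\<close>
  define \<beta> where "\<beta> = c1 + 2 * c2 * z0 + cnj z0 * (a - 1)"
  define \<kappa> where "\<kappa> = (1 - (cmod a)\<^sup>2) / 2"
  have \<kappa>: "0 < \<kappa>" using a abs_square_less_1[of "cmod a"] by (simp add: \<kappa>_def)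
  have a1: "a \<noteq> 1" using a by auto
  have psi: "\<psi> (z0 + x) = z0 + a * x" for x
    using affine_funpow[OF \<psi> a1, of 1 x] by (simp add: z0_def)
  have expand: "comp_multiplier u \<psi> (z0 + x) = cmod (u z0) * exp (Re (\<beta> * x) + Re (c2 * x\<^sup>2) - \<kappa> * (cmod x)\<^sup>2)" for x
  proof -
    have n: "(cmod (z0 + y))\<^sup>2 = (cmod z0)\<^sup>2 + 2 * Re (cnj z0 * y) + (cmod y)\<^sup>2" for y
      unfolding cmod_power2 by (simp add: power2_eq_square algebra_simps)
    have "q (z0 + x) = q z0 + (c1 + 2 * c2 * z0) * x + c2 * x\<^sup>2"
      by (simp add: c power2_eq_square algebra_simps)
    then have "Re (q (z0 + x)) = Re (q z0) + Re ((c1 + 2 * c2 * z0) * x) + Re (c2 * x\<^sup>2)"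
      by (simp only: plus_complex.sel)
    moreover have "((cmod (\<psi> (z0 + x)))\<^sup>2 - (cmod (z0 + x))\<^sup>2) / 2 = Re (cnj z0 * (a - 1) * x) - \<kappa> * (cmod x)\<^sup>2"
      unfolding psi n \<kappa>_def by (simp add: norm_mult power_mult_distrib field_simps)
    moreover have "Re (\<beta> * x) = Re ((c1 + 2 * c2 * z0) * x) + Re (cnj z0 * (a - 1) * x)"
      unfolding \<beta>_def distrib_right by (simp only: plus_complex.sel)
    ultimately have "Re (q (z0 + x)) + ((cmod (\<psi> (z0 + x)))\<^sup>2 - (cmod (z0 + x))\<^sup>2) / 2
        = Re (q z0) + (Re (\<beta> * x) + Re (c2 * x\<^sup>2) - \<kappa> * (cmod x)\<^sup>2)" by linarith
    then show ?thesis unfolding mult by (simp only: exp_add norm_exp_eq_Re flip: q(2))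
  qed
  have c2: "cmod c2 < \<kappa>"
  proof (rule ccontr)
    assume "\<not> cmod c2 < \<kappa>"
    then have ge: "\<kappa> \<le> cmod c2" by simp
    then have c2nz: "c2 \<noteq> 0" using \<kappa> by auto
    \<comment> \<open>A square root of the conjugate phase of \<open>c2\<close>, so that
      \<open>c2 * t0^2\<close> is real and positive.\<close>
    define t0 where "t0 = csqrt (of_real (cmod c2) / c2)"
    have t0: "c2 * t0\<^sup>2 = of_real (cmod c2)" using c2nz by (simp add: t0_def)
    \<comment> \<open>the direction in which \<open>c2 * x\<^sup>2\<close> is largest, with the sign that makes the linear term nonnegative\<close>
    define t where "t = (if 0 \<le> Re (\<beta> * t0) then t0 else - t0)"
    have t: "c2 * t\<^sup>2 = of_real (cmod c2)" "0 \<le> Re (\<beta> * t)" using t0 by (auto simp: t_def)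
    have "cmod c2 * (cmod t)\<^sup>2 = cmod c2 * 1" using arg_cong[OF t(1), of cmod] by (simp add: norm_mult norm_power)
    then have nt: "cmod t = 1" using c2nz by (simp add: power2_eq_1_iff norm_ge_zero) (smt (verit) norm_ge_zero)
    \<comment> \<open>Along this ray neither the linear nor the quadratic part of the exponent is
      negative, so the multiplier never falls below \<open>cmod (u z0)\<close>, against
      compactness.\<close>
    define x where "x = (\<lambda>n. z0 + of_nat n * t)"
    have ge0: "cmod (u z0) \<le> comp_multiplier u \<psi> (x n)" for n
    proof -
      have "Re (c2 * (of_nat n * t)\<^sup>2) = (real n)\<^sup>2 * cmod c2"
        by (simp add: power_mult_distrib mult.left_commute[of c2] t)
      moreover have "Re (\<beta> * (of_nat n * t)) = real n * Re (\<beta> * t)"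
        by (simp add: mult.left_commute[of \<beta>])
      moreover have "(cmod (of_nat n * t))\<^sup>2 = (real n)\<^sup>2" by (simp add: norm_mult nt)
      ultimately have "Re (\<beta> * (of_nat n * t)) + Re (c2 * (of_nat n * t)\<^sup>2) - \<kappa> * (cmod (of_nat n * t))\<^sup>2
         = real n * Re (\<beta> * t) + (real n)\<^sup>2 * (cmod c2 - \<kappa>)" by (simp add: algebra_simps)
      moreover have "0 \<le> \<dots>" using t(2) ge by auto
      ultimately show ?thesis unfolding x_def expand by (simp add: mult_le_cancel_left1)
    qed
    have "filterlim (\<lambda>n. z0 + (a * t) * of_nat n) at_infinity sequentially"
      by (intro tendsto_add_filterlim_at_infinity[OF tendsto_const]
            tendsto_mult_filterlim_at_infinity[OF tendsto_const] tendsto_of_nat)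
         (use a nt in auto)
    then have "filterlim (\<lambda>n. \<psi> (x n)) at_infinity sequentially"
      by (simp add: x_def psi mult_ac)
    then obtain r where "(\<lambda>n. comp_multiplier u \<psi> (x (r n))) \<longlonglongrightarrow> 0"
      using comp_multiplier_vanishes_at_infinity[OF p T] by blast
    then have "cmod (u z0) \<le> 0"
      by (rule tendsto_lowerbound) (use ge0 in auto)
    then show False using u(2)[of z0] by simp
  qed
  have "comp_multiplier u \<psi> (z0 + x) \<le> cmod (u z0) * exp (cmod \<beta> * cmod x - (\<kappa> - cmod c2) * (cmod x)\<^sup>2)" for x
  proof -
    have "Re (\<beta> * x) \<le> cmod \<beta> * cmod x" using complex_Re_le_cmod[of "\<beta> * x"] by (simp add: norm_mult)
    moreover have "Re (c2 * x\<^sup>2) \<le> cmod c2 * (cmod x)\<^sup>2" using complex_Re_le_cmod[of "c2 * x\<^sup>2"] by (simp add: norm_mult norm_power)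
    ultimately show ?thesis unfolding expand by (intro mult_left_mono) (auto simp: algebra_simps)
  qed
  with c2 show ?thesis by (intro that[of "cmod \<beta>" "\<kappa> - cmod c2"]) auto
qed

section \<open>Uniform bounds for the powers\<close>

lemma bounded_operator_on_funpow:
  assumes "bounded_operator_on V N T" "f \<in> V"
  shows "(T ^^ n) f \<in> V"
  using assms by (induction n) (auto simp: bounded_operator_on_def)

text \<open>The linear terms sum to a geometric series; of the quadratic terms only \<open>j = 0\<close> is kept.\<close>
lemma comp_multiplier_prod_gaussian:
  assumes \<psi>: "\<And>z. \<psi> z = a * z + b" and a: "cmod a < 1"
    and L: "0 \<le> L" and \<epsilon>: "0 < \<epsilon>" and n: "0 < n"
    and u: "cmod (u (b / (1 - a))) \<le> 1"
    and le: "\<And>x. comp_multiplier u \<psi> (b / (1 - a) + x) \<le> cmod (u (b / (1 - a))) * exp (L * cmod x - \<epsilon> * (cmod x)\<^sup>2)"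
  shows "(\<Prod>j<n. comp_multiplier u \<psi> ((\<psi> ^^ j) z)) \<le>
    exp ((L / (1 - cmod a))\<^sup>2 / (2 * \<epsilon>)) * exp (- (\<epsilon> / 2) * (cmod (z - b / (1 - a)))\<^sup>2)"
proof -
  define z0 where "z0 = b / (1 - a)"
  define x where "x = z - z0"
  define r where "r = cmod x"
  define M where "M = L / (1 - cmod a)"
  have a1: "a \<noteq> 1" using a by auto
  have z: "z = z0 + x" by (simp add: x_def)
  have "(\<Prod>j<n. comp_multiplier u \<psi> ((\<psi> ^^ j) z)) \<le>
        (\<Prod>j<n. exp (L * (cmod a ^ j * r) - \<epsilon> * (cmod a ^ j * r)\<^sup>2))"
  proof (intro prod_mono conjI)
    fix j
    have "comp_multiplier u \<psi> ((\<psi> ^^ j) z) = comp_multiplier u \<psi> (z0 + a ^ j * x)"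
      unfolding z z0_def by (simp add: affine_funpow[OF \<psi> a1])
    also have "\<dots> \<le> cmod (u z0) * exp (L * cmod (a ^ j * x) - \<epsilon> * (cmod (a ^ j * x))\<^sup>2)"
      unfolding z0_def by (rule le)
    \<comment> \<open>The only use of the bound at the fixed point: the factors
      \<open>cmod (u z0)\<close> do not accumulate over the orbit.\<close>
    also have "\<dots> \<le> 1 * exp (L * cmod (a ^ j * x) - \<epsilon> * (cmod (a ^ j * x))\<^sup>2)"
      using u by (intro mult_right_mono) (auto simp: z0_def)
    finally show "comp_multiplier u \<psi> ((\<psi> ^^ j) z) \<le> exp (L * (cmod a ^ j * r) - \<epsilon> * (cmod a ^ j * r)\<^sup>2)"
      by (simp add: norm_mult norm_power r_def)
  qed simp
  also have "\<dots> = exp (\<Sum>j<n. L * (cmod a ^ j * r) - \<epsilon> * (cmod a ^ j * r)\<^sup>2)"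
    by (simp add: exp_sum)
  also have "\<dots> \<le> exp (M\<^sup>2 / (2 * \<epsilon>) - \<epsilon> / 2 * r\<^sup>2)"
  proof -
    have "(\<Sum>j<n. L * (cmod a ^ j * r)) = L * r * (\<Sum>j<n. cmod a ^ j)"
      by (simp add: sum_distrib_left mult_ac)
    also have "(\<Sum>j<n. cmod a ^ j) \<le> 1 / (1 - cmod a)"
      using a by (simp add: sum_gp_strict divide_right_mono)
    then have "L * r * (\<Sum>j<n. cmod a ^ j) \<le> L * r * (1 / (1 - cmod a))"
      using L by (intro mult_left_mono) (auto simp: r_def)
    finally have 1: "(\<Sum>j<n. L * (cmod a ^ j * r)) \<le> M * r" by (simp add: M_def)
    have "(\<Sum>j\<in>{0}. \<epsilon> * (cmod a ^ j * r)\<^sup>2) \<le> (\<Sum>j<n. \<epsilon> * (cmod a ^ j * r)\<^sup>2)"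
      using \<epsilon> n by (intro sum_mono2) auto
    then have 2: "\<epsilon> * r\<^sup>2 \<le> (\<Sum>j<n. \<epsilon> * (cmod a ^ j * r)\<^sup>2)" by simp
    \<comment> \<open>Completing the square: half of the quadratic decay absorbs the linear term, at
      the price of a constant independent of \<open>n\<close>.\<close>
    have "0 \<le> (M - \<epsilon> * r)\<^sup>2 / (2 * \<epsilon>)" using \<epsilon> by simp
    also have "\<dots> = M\<^sup>2 / (2 * \<epsilon>) - M * r + \<epsilon> / 2 * r\<^sup>2"
      using \<epsilon> by (simp add: power2_eq_square field_simps)
    finally have 3: "M * r \<le> M\<^sup>2 / (2 * \<epsilon>) + \<epsilon> / 2 * r\<^sup>2" by simp
    show ?thesis using 1 2 3 by (simp add: sum_subtractf)
  qed
  also have "\<dots> = exp ((L / (1 - cmod a))\<^sup>2 / (2 * \<epsilon>)) * exp (- (\<epsilon> / 2) * (cmod (z - b / (1 - a)))\<^sup>2)"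
    by (simp add: M_def r_def x_def z0_def flip: exp_add)
  finally show ?thesis .
qed

proposition weighted_comp_powers_bounded:
  assumes p: "1 \<le> p" and u: "u holomorphic_on UNIV" "\<And>z. u z \<noteq> 0"
    and \<psi>: "\<And>z. \<psi> z = a * z + b" and a: "cmod a < 1"
    and T: "compact_operator_on (fock_space p) (fock_norm p) (weighted_comp u \<psi>)"
    and u0: "cmod (u (b / (1 - a))) \<le> 1"
  obtains C where
    "\<And>f n. f \<in> fock_space p \<Longrightarrow> fock_norm p ((weighted_comp u \<psi> ^^ n) f) \<le> C * fock_norm p f"
proof -
  let ?T = "weighted_comp u \<psi>"
  have bT: "bounded_operator_on (fock_space p) (fock_norm p) ?T"
    using T by (simp add: compact_operator_on_def)
  \<comment> \<open>The identity, \<open>n = 0\<close>, has no Gaussian decay and is covered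
    afterwards by \<open>max 1 C\<close>.\<close>
  have "\<exists>C. \<forall>f\<in>fock_space p. \<forall>n>0. fock_norm p ((?T ^^ n) f) \<le> C * fock_norm p f"
  proof (cases "a = 0")
    case True
    obtain C where C: "\<And>f. f \<in> fock_space p \<Longrightarrow> fock_norm p (?T f) \<le> C * fock_norm p f"
      using bT unfolding bounded_operator_on_def by blast
    have "fock_norm p ((?T ^^ n) f) \<le> C * fock_norm p f" if f: "f \<in> fock_space p" and n: "n > 0" for f n
    proof -
      obtain m where m: "n = Suc m" using n by (cases n) auto
      \<comment> \<open>For constant \<open>\<psi>\<close> the operator has rank at most one:
        \<open>?T f\<close> is \<open>f b\<close> times \<open>u\<close>, and each further
        application multiplies by \<open>u b\<close>.\<close>
      have "(?T ^^ Suc m) f = (\<lambda>z. u b ^ m * ?T f z)" for m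
      proof (induction m)
        case (Suc m)
        show ?case
          by (subst funpow.simps(2), unfold comp_def, subst Suc) (rule ext, simp add: weighted_comp_def \<psi> True)
      qed simp
      then have "fock_norm p ((?T ^^ n) f) = cmod (u b) ^ m * fock_norm p (?T f)"
        unfolding m using bounded_operator_on_funpow[OF bT f, of 1] by (simp add: fock_space_scale[OF p] norm_power)
      also have "\<dots> \<le> 1 * fock_norm p (?T f)"
        using u0 True bounded_operator_on_funpow[OF bT f, of 1]
        by (intro mult_right_mono fock_norm_nonneg[OF p] power_le_one) auto
      also have "\<dots> \<le> C * fock_norm p f" using C[OF f] by simp
      finally show ?thesis .
    qed
    then show ?thesis by blast
  next
    case False
    obtain K where K: "0 \<le> K" "\<And>f z. f \<in> fock_space p \<Longrightarrow> fock_weight f z \<le> K * fock_norm p f"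
      using fock_point_evaluation[OF p] by blast
    obtain L \<epsilon> where L: "0 \<le> L" and \<epsilon>: "0 < \<epsilon>"
      and le: "\<And>x. comp_multiplier u \<psi> (b / (1 - a) + x) \<le> cmod (u (b / (1 - a))) * exp (L * cmod x - \<epsilon> * (cmod x)\<^sup>2)"
      using comp_multiplier_gaussian_decay[OF p u \<psi> a False T] by blast
    obtain C where C: "\<And>f c A. f holomorphic_on UNIV \<Longrightarrow> 0 \<le> A \<Longrightarrow>
       (\<And>z. fock_weight f z \<le> A * exp (- (\<epsilon> / 2) * (cmod (z - c))\<^sup>2)) \<Longrightarrow>
       f \<in> fock_space p \<and> fock_norm p f \<le> C * A"
      using fock_gaussian_domination[OF p half_gt_zero[OF \<epsilon>]] by blast
    define E where "E = exp ((L / (1 - cmod a))\<^sup>2 / (2 * \<epsilon>))"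
    have "fock_norm p ((?T ^^ n) f) \<le> (C * (E * K)) * fock_norm p f"
      if f: "f \<in> fock_space p" and n: "n > 0" for f n
    proof -
      \<comment> \<open>The product of multipliers supplies the Gaussian; the remaining factor, the
        weight of \<open>f\<close> at the end of the orbit, is bounded by point evaluation.\<close>
      have "fock_weight ((?T ^^ n) f) z \<le> (E * (K * fock_norm p f)) * exp (- (\<epsilon> / 2) * (cmod (z - b / (1 - a)))\<^sup>2)" for z
      proof -
        have "fock_weight ((?T ^^ n) f) z \<le>
            (E * exp (- (\<epsilon> / 2) * (cmod (z - b / (1 - a)))\<^sup>2)) * (K * fock_norm p f)"
          unfolding fock_weight_weighted_comp_funpow E_def
          by (intro mult_mono comp_multiplier_prod_gaussian[OF \<psi> a L \<epsilon> n u0 le] K(2)[OF f]) auto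
        then show ?thesis by (simp add: mult_ac)
      qed
      then have "fock_norm p ((?T ^^ n) f) \<le> C * (E * (K * fock_norm p f))"
        using K(1) fock_norm_nonneg[OF p f] fock_space_holomorphic[OF bounded_operator_on_funpow[OF bT f]]
        by (intro C[THEN conjunct2]) (auto simp: E_def)
      then show ?thesis by (simp add: mult.assoc)
    qed
    then show ?thesis by blast
  qed
  then obtain C where C: "\<And>f n. f \<in> fock_space p \<Longrightarrow> n > 0 \<Longrightarrow> fock_norm p ((?T ^^ n) f) \<le> C * fock_norm p f"
    by blast
  have "fock_norm p ((?T ^^ n) f) \<le> max 1 C * fock_norm p f" if f: "f \<in> fock_space p" for f n
  proof (cases "n > 0")
    case True
    from C[OF f this] show ?thesis
      using mult_right_mono[OF max.cobounded2[of C 1] fock_norm_nonneg[OF p f]] by linarith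
  next
    case False
    then show ?thesis
      using mult_right_mono[OF max.cobounded1[of 1 C] fock_norm_nonneg[OF p f]] by simp
  qed
  then show ?thesis by (rule that)
qed

section \<open>The equivalence\<close>

lemma fock_space_const_one: "1 \<le> p \<Longrightarrow> (\<lambda>_. 1) \<in> fock_space p"
  by (erule fock_kernel_bounded) (simp add: fock_kernel_zero[symmetric])

text \<open>The operator norm is a real supremum and bounds its members only once the set is known
  to be bounded above; the powers of \<open>\<bar>C\<bar>\<close> show this for each
  \<open>n\<close>.\<close>

lemma operator_norm_funpow_upper:
  assumes p: "1 \<le> p" and T: "bounded_operator_on (fock_space p) (fock_norm p) T"
    and f: "f \<in> fock_space p" "fock_norm p f \<le> 1"
  shows "fock_norm p ((T ^^ n) f) \<le> operator_norm_on (fock_space p) (fock_norm p) (T ^^ n)"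
proof -
  obtain C where C: "\<And>f. f \<in> fock_space p \<Longrightarrow> fock_norm p (T f) \<le> C * fock_norm p f"
    using T unfolding bounded_operator_on_def by blast
  have "fock_norm p ((T ^^ n) f) \<le> \<bar>C\<bar> ^ n" if f: "f \<in> fock_space p" "fock_norm p f \<le> 1" for f
  proof (induction n)
    case (Suc n)
    have V: "(T ^^ n) f \<in> fock_space p" by (rule bounded_operator_on_funpow[OF T f(1)])
    have "fock_norm p ((T ^^ Suc n) f) \<le> C * fock_norm p ((T ^^ n) f)" using C[OF V] by simp
    also have "\<dots> \<le> \<bar>C\<bar> * \<bar>C\<bar> ^ n" by (intro mult_mono Suc.IH fock_norm_nonneg[OF p V]) auto
    finally show ?case by simp
  qed (use f in simp)
  then show ?thesis
    unfolding operator_norm_on_def using f by (intro cSUP_upper) (auto intro!: bdd_aboveI2)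
qed

theorem theorem2p3:
  fixes p :: ereal and u \<psi> :: "complex \<Rightarrow> complex" and a b :: complex
  assumes "1 \<le> p"
    and "u holomorphic_on UNIV" and "\<psi> holomorphic_on UNIV"
    and "bounded_operator_on (fock_space p) (fock_norm p) (weighted_comp u \<psi>)"
    and "\<And>z. \<psi> z = a * z + b" and "cmod a < 1"
    and "\<And>z. u z \<noteq> 0"
    and "compact_operator_on (fock_space p) (fock_norm p) (weighted_comp u \<psi>)"
  shows "(power_bounded_on (fock_space p) (fock_norm p) (weighted_comp u \<psi>) \<longleftrightarrow>
          (\<forall>n. weight_iter u \<psi> n \<in> fock_space p) \<and>
          Bseq (\<lambda>n. fock_norm p (weight_iter u \<psi> n)))
       \<and> ((\<forall>n. weight_iter u \<psi> n \<in> fock_space p) \<and>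
          Bseq (\<lambda>n. fock_norm p (weight_iter u \<psi> n)) \<longleftrightarrow>
          cmod (u (b / (1 - a))) \<le> 1)"
    (is "(?i \<longleftrightarrow> ?ii) \<and> (?ii \<longleftrightarrow> ?iii)")
proof -
  let ?V = "fock_space p" and ?N = "fock_norm p" and ?T = "weighted_comp u \<psi>"
  note p = assms(1) and T = assms(4) and \<psi> = assms(5)
  have a1: "a \<noteq> 1" using assms(6) by auto
  have iter: "weight_iter u \<psi> n = (?T ^^ n) (\<lambda>_. 1)" for n
    by (simp add: weighted_comp_funpow)
  \<comment> \<open>The membership part of (ii) thus holds unconditionally, and only the norms are
    at stake below.\<close>
  have iterV: "weight_iter u \<psi> n \<in> ?V" for n
    unfolding iter by (rule bounded_operator_on_funpow[OF T fock_space_const_one[OF p]])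
  have i_ii: ?ii if i: ?i
  proof -
    obtain C where C: "\<And>n. operator_norm_on ?V ?N (?T ^^ n) \<le> C"
      using i unfolding power_bounded_on_def bdd_above_def by auto
    \<comment> \<open>Scales the constant 1 into the unit ball; the added 1 keeps the denominator
      positive without computing the norm.\<close>
    define t where "t = 1 / (1 + ?N (\<lambda>_. 1))"
    have N1: "0 \<le> ?N (\<lambda>_. 1)" by (intro fock_norm_nonneg fock_space_const_one p)
    then have t: "0 < t" by (simp add: t_def)
    have sc: "(\<lambda>z. of_real t * 1) \<in> ?V" "?N (\<lambda>z. of_real t * 1) = cmod (of_real t) * ?N (\<lambda>_. 1)"
      using fock_space_scale[OF p fock_space_const_one[OF p], of "of_real t"] by auto
    have N2: "?N (\<lambda>z. of_real t * 1) \<le> 1"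
    proof -
      have "cmod (of_real t) = t" using t by simp
      then show ?thesis unfolding sc(2) using N1 by (simp add: t_def)
    qed
    have "?N (weight_iter u \<psi> n) \<le> C / t" for n
    proof -
      have "(?T ^^ n) (\<lambda>z. of_real t * 1) = (\<lambda>z. of_real t * weight_iter u \<psi> n z)"
        by (simp add: weighted_comp_funpow mult.commute)
      then have "t * ?N (weight_iter u \<psi> n) = ?N ((?T ^^ n) (\<lambda>z. of_real t * 1))"
        using t fock_space_scale(2)[OF p iterV, of "of_real t" n] by simp
      also have "\<dots> \<le> C" using operator_norm_funpow_upper[OF p T sc(1) N2] C order_trans by blast
      finally show ?thesis using t by (simp add: field_simps)
    qed
    then show ?thesis using iterV fock_norm_nonneg[OF p iterV]
      by (auto intro!: BseqI'[where K="C / t"])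
  qed
  have ii_iii: ?iii if ii: ?ii
  proof (rule ccontr)
    define z0 where "z0 = b / (1 - a)"
    assume "\<not> ?iii"
    then have gt: "1 < cmod (u z0)" by (simp add: z0_def)
    obtain K where K: "0 \<le> K" "\<And>f z. f \<in> ?V \<Longrightarrow> fock_weight f z \<le> K * ?N f"
      using fock_point_evaluation[OF p] by blast
    obtain M where M: "\<And>n. ?N (weight_iter u \<psi> n) \<le> M"
      using ii unfolding Bseq_def by (auto simp: abs_le_iff)
    define e where "e = exp (- (cmod z0)\<^sup>2 / 2)"
    have e: "0 < e" by (simp add: e_def)
    have pow: "cmod (u z0) ^ n \<le> K * M / e" for n
    proof -
      \<comment> \<open>At the fixed point the weight of the iterate is a pure power of
        \<open>u z0\<close>, so bounded norms and point evaluation would bound a diverging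
        sequence.\<close>
      have "(\<psi> ^^ j) z0 = z0" for j
        using affine_funpow[OF \<psi> a1, of j 0] by (simp add: z0_def)
      then have "weight_iter u \<psi> n z0 = u z0 ^ n" by (simp add: weight_iter_def)
      then have "cmod (u z0) ^ n * e = fock_weight (weight_iter u \<psi> n) z0"
        by (simp add: fock_weight_def e_def norm_power)
      also have "\<dots> \<le> K * ?N (weight_iter u \<psi> n)" by (intro K iterV)
      also have "\<dots> \<le> K * M" by (intro mult_left_mono M K)
      finally show ?thesis using e by (simp add: field_simps)
    qed
    obtain n where "K * M / e < cmod (u z0) ^ n" using real_arch_pow[OF gt] by blast
    with pow[of n] show False by linarith
  qed
  have iii_i: ?i if iii: ?iii
  proof -
    obtain C where C: "\<And>f n. f \<in> ?V \<Longrightarrow> ?N ((?T ^^ n) f) \<le> C * ?N f"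
      using weighted_comp_powers_bounded[OF p assms(2,7,5,6,8) iii] by blast
    have "operator_norm_on ?V ?N (?T ^^ n) \<le> \<bar>C\<bar>" for n
      unfolding operator_norm_on_def
    proof (rule cSUP_least)
      \<comment> \<open>The zero function shows that the supremum is not taken over the empty set,
        where it would be unspecified.\<close>
      have "(\<lambda>z. 0 * 1) \<in> ?V" "?N (\<lambda>z. 0 * 1) \<le> 1"
        using fock_space_scale[OF p fock_space_const_one[OF p], of 0] by auto
      then show "{f \<in> ?V. ?N f \<le> 1} \<noteq> {}" by blast
      fix f assume f: "f \<in> {f \<in> ?V. ?N f \<le> 1}"
      then have "?N ((?T ^^ n) f) \<le> C * ?N f" by (intro C) simp
      also have "\<dots> \<le> \<bar>C\<bar> * 1" using f by (intro mult_mono fock_norm_nonneg[OF p]) auto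
      finally show "?N ((?T ^^ n) f) \<le> \<bar>C\<bar>" by simp
    qed
    then show ?thesis using T by (auto simp: power_bounded_on_def intro!: bdd_aboveI2)
  qed
  show ?thesis using i_ii ii_iii iii_i by blast
qed

end
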